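(* Let $\Delta$ be a finite polar space of rank $n\ge 3$ and order $(s,\dots,s,t)$, and let $(n-2)/2\le i<j\le n-1$. Then $(\Delta_i,\perp)\not\cong(\Delta_j,\perp)$, $(\Delta_i,\perp\cup\approx)\not\cong(\Delta_j,\perp\cup\approx)$ and $(\Delta_i,\perp_{\max})\not\cong(\Delta_j,\perp_{\max})$.
   Context: $\Delta$ is a finite non-degenerate polar space of rank $n\ge3$ of order $(s,\dots,s,t)$: $s,t$ are positive integers with $s>1$ and $t\in\{1,s^{1/2},s,s^{3/2},s^2\}$, every line has $s+1$ points and every singular subspace of projective dimension $n-2$ lies in exactly $t+1$ maximal singular subspaces (which have projective dimension $n-1$). $\Delta_u$ is the set of singular subspaces of projective dimension $u$. For $X,Y\in\Delta_u$: $X\perp Y$ means every point of $X$ is collinear with every point of $Y$; $X\approx Y$ means $\dim(X\cap Y)=u-1$; $X\perp_{\max}Y$ means $X\perp Y$ and $\dim\langle X,Y\rangle=n-1$. $(\Delta_u,\perp)$, $(\Delta_u,\perp\cup\approx)$, $(\Delta_u,\perp_{\max})$ are the graphs on vertex set $\Delta_u$ in which distinct $X,Y$ are adjacent iff respectively $X\perp Y$; $X\perp Y$ or $X\approx Y$; $X\perp_{\max}Y$. *)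

theory Defs
  imports Complex_Main "Graph_Theory.Graph_Theory"
begin

text \<open>
  A point-line geometry is given by a set \<open>P\<close> of points and a set \<open>L\<close> of lines, each line being
  the set of its points.  Every point counts as collinear with itself.
\<close>

definition pt_collinear :: "'a set set \<Rightarrow> 'a \<Rightarrow> 'a \<Rightarrow> bool" where
  "pt_collinear L p q \<longleftrightarrow> p = q \<or> (\<exists>l\<in>L. p \<in> l \<and> q \<in> l)"

text \<open>
  The Buekenhout-Shult axioms.  Since \<open>P\<close> is finite, the axiom that nested sequences of singular
  subspaces are finite holds automatically.  Partial linearity is redundant: it follows from the
  other axioms (Buekenhout and Shult).
\<close>

locale finite_polar_space =
  fixes P :: "'a set" and L :: "'a set set"
  assumes finite_points: "finite P"
    and line_subset: "\<And>l. l \<in> L \<Longrightarrow> l \<subseteq> P"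
    and line_card_ge_3: "\<And>l. l \<in> L \<Longrightarrow> card l \<ge> 3"
    and partial_linear:
      "\<And>l m p q. \<lbrakk>l \<in> L; m \<in> L; p \<noteq> q; p \<in> l; q \<in> l; p \<in> m; q \<in> m\<rbrakk> \<Longrightarrow> l = m"
    and one_or_all:
      "\<And>p l. \<lbrakk>p \<in> P; l \<in> L\<rbrakk> \<Longrightarrow>
         (\<exists>!q. q \<in> l \<and> pt_collinear L p q) \<or> (\<forall>q\<in>l. pt_collinear L p q)"
    and nondegenerate: "\<And>p. p \<in> P \<Longrightarrow> \<exists>q\<in>P. \<not> pt_collinear L p q"

definition geom_subspace :: "'a set \<Rightarrow> 'a set set \<Rightarrow> 'a set \<Rightarrow> bool" where
  "geom_subspace P L S \<longleftrightarrow>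
     S \<subseteq> P \<and> (\<forall>l\<in>L. \<forall>p\<in>S. \<forall>q\<in>S. p \<noteq> q \<and> p \<in> l \<and> q \<in> l \<longrightarrow> l \<subseteq> S)"

definition geom_span :: "'a set \<Rightarrow> 'a set set \<Rightarrow> 'a set \<Rightarrow> 'a set" where
  "geom_span P L A = \<Inter>{S. geom_subspace P L S \<and> A \<subseteq> S}"

definition perp :: "'a set set \<Rightarrow> 'a set \<Rightarrow> 'a set \<Rightarrow> bool" where
  "perp L X Y \<longleftrightarrow> (\<forall>x\<in>X. \<forall>y\<in>Y. pt_collinear L x y)"

definition singular_subspace :: "'a set \<Rightarrow> 'a set set \<Rightarrow> 'a set \<Rightarrow> bool" where
  "singular_subspace P L X \<longleftrightarrow> geom_subspace P L X \<and> perp L X X"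

definition maximal_singular :: "'a set \<Rightarrow> 'a set set \<Rightarrow> 'a set \<Rightarrow> bool" where
  "maximal_singular P L M \<longleftrightarrow>
     singular_subspace P L M \<and> (\<forall>X. singular_subspace P L X \<and> M \<subseteq> X \<longrightarrow> X = M)"

text \<open>
  Projective dimension: one less than the least number of points that generate the subspace, so
  the empty subspace has dimension \<open>-1\<close>, points have dimension \<open>0\<close> and lines dimension \<open>1\<close>.
\<close>

definition proj_dim :: "'a set \<Rightarrow> 'a set set \<Rightarrow> 'a set \<Rightarrow> int" where
  "proj_dim P L X =
     int (LEAST k. \<exists>A. A \<subseteq> X \<and> finite A \<and> card A = k \<and> geom_span P L A = X) - 1"

definition has_polar_rank :: "'a set \<Rightarrow> 'a set set \<Rightarrow> nat \<Rightarrow> bool" where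
  "has_polar_rank P L n \<longleftrightarrow> (\<forall>M. maximal_singular P L M \<longrightarrow> proj_dim P L M = int n - 1)"

text \<open>
  Order \<open>(s, \<dots>, s, t)\<close> of a polar space of rank \<open>n\<close>, including the standing restriction on the
  possible values of \<open>t\<close>.
\<close>

definition has_polar_order :: "'a set \<Rightarrow> 'a set set \<Rightarrow> nat \<Rightarrow> nat \<Rightarrow> nat \<Rightarrow> bool" where
  "has_polar_order P L n s t \<longleftrightarrow>
     1 < s \<and> 0 < t \<and>
     real t \<in> {1, real s powr (1/2), real s, real s powr (3/2), real s ^ 2} \<and>
     (\<forall>l\<in>L. card l = s + 1) \<and>
     (\<forall>U. singular_subspace P L U \<and> proj_dim P L U = int n - 2 \<longrightarrow>
        card {M. maximal_singular P L M \<and> U \<subseteq> M} = t + 1)"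

definition Delta :: "'a set \<Rightarrow> 'a set set \<Rightarrow> nat \<Rightarrow> 'a set set" where
  "Delta P L u = {X. singular_subspace P L X \<and> proj_dim P L X = int u}"

definition hyp_adjacent :: "'a set \<Rightarrow> 'a set set \<Rightarrow> nat \<Rightarrow> 'a set \<Rightarrow> 'a set \<Rightarrow> bool" where
  "hyp_adjacent P L u X Y \<longleftrightarrow> proj_dim P L (X \<inter> Y) = int u - 1"

definition perp_max :: "'a set \<Rightarrow> 'a set set \<Rightarrow> nat \<Rightarrow> 'a set \<Rightarrow> 'a set \<Rightarrow> bool" where
  "perp_max P L n X Y \<longleftrightarrow> perp L X Y \<and> proj_dim P L (geom_span P L (X \<union> Y)) = int n - 1"

text \<open>
  The simple graph on \<open>V\<close> in which distinct vertices are adjacent iff they are related by \<open>R\<close>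
  (for symmetric \<open>R\<close>), encoded as a digraph with both arcs for each edge.
\<close>

definition graph_of :: "'b set \<Rightarrow> ('b \<Rightarrow> 'b \<Rightarrow> bool) \<Rightarrow> 'b pair_pre_digraph" where
  "graph_of V R = \<lparr>pverts = V, parcs = {(x, y). x \<in> V \<and> y \<in> V \<and> x \<noteq> y \<and> R x y}\<rparr>"

abbreviation graph_iso :: "'b pair_pre_digraph \<Rightarrow> 'c pair_pre_digraph \<Rightarrow> bool" where
  "graph_iso G H \<equiv> digraph_iso (with_proj G) (with_proj H)"

lemma graph_iso_graph_of_iff:
  "graph_iso (graph_of V R) (graph_of W S) \<longleftrightarrow>
     (\<exists>f. bij_betw f V W \<and>
       (\<forall>x\<in>V. \<forall>y\<in>V. x \<noteq> y \<longrightarrow> (R x y \<longleftrightarrow> S (f x) (f y))))" (is "?l \<longleftrightarrow> ?r")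
proof
  assume ?l
  then obtain h where
    h: "pre_digraph.digraph_isomorphism (with_proj (graph_of V R)) h"
    and eq: "with_proj (graph_of W S) = app_iso h (with_proj (graph_of V R))"
    unfolding digraph_iso_def by blast
  let ?f = "iso_verts h"
  let ?A = "parcs (graph_of V R)" and ?B = "parcs (graph_of W S)"
  have inj: "inj_on ?f V"
    using h by (simp add: pre_digraph.digraph_isomorphism_def graph_of_def)
  have W: "W = ?f ` V"
    using arg_cong[OF eq, of verts] by (simp add: graph_of_def)
  have B: "?B = iso_arcs h ` ?A"
    using arg_cong[OF eq, of arcs] by simp
  have hd: "iso_tail h = fst" "iso_head h = snd"
    using arg_cong[OF eq, of tail] arg_cong[OF eq, of head] by simp_all
  have arc: "iso_arcs h a = (?f (fst a), ?f (snd a))" if "a \<in> ?A" for a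
    using h that by (simp add: pre_digraph.digraph_isomorphism_def hd prod_eq_iff)
  have B': "?B = (\<lambda>a. (?f (fst a), ?f (snd a))) ` ?A"
    unfolding B by (rule image_cong) (simp_all add: arc)
  have "R x y \<longleftrightarrow> S (?f x) (?f y)" if xy: "x \<in> V" "y \<in> V" "x \<noteq> y" for x y
  proof -
    have "R x y \<longleftrightarrow> (x, y) \<in> ?A"
      using xy by (simp add: graph_of_def)
    also have "\<dots> \<longleftrightarrow> (?f x, ?f y) \<in> ?B"
      unfolding B' using xy inj by (auto simp: graph_of_def image_iff inj_on_eq_iff)
    also have "\<dots> \<longleftrightarrow> S (?f x) (?f y)"
      using xy inj by (auto simp: graph_of_def W inj_on_eq_iff)
    finally show ?thesis .
  qed
  then show ?r
    using inj W by (auto simp: bij_betw_def)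
next
  assume ?r
  then obtain f where f: "inj_on f V" "W = f ` V"
    and RS: "\<And>x y. x \<in> V \<Longrightarrow> y \<in> V \<Longrightarrow> x \<noteq> y \<Longrightarrow> R x y \<longleftrightarrow> S (f x) (f y)"
    by (auto simp: bij_betw_def)
  let ?h = "\<lparr>iso_verts = f, iso_arcs = map_prod f f, iso_head = snd, iso_tail = fst\<rparr>"
  have "wf_digraph (with_proj (graph_of V R))"
    by unfold_locales (auto simp: graph_of_def)
  moreover have "inj_on (map_prod f f) (parcs (graph_of V R))"
    using f(1) by (auto simp: graph_of_def inj_on_def)
  ultimately have "pre_digraph.digraph_isomorphism (with_proj (graph_of V R)) ?h"
    using f(1) by (simp add: pre_digraph.digraph_isomorphism_def) (simp add: graph_of_def)
  moreover have "parcs (graph_of W S) = map_prod f f ` parcs (graph_of V R)"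
    using f RS by (fastforce simp: graph_of_def inj_on_eq_iff image_iff)
  then have "with_proj (graph_of W S) = app_iso ?h (with_proj (graph_of V R))"
    using f(2) by (simp add: app_iso_def with_proj_def) (simp add: graph_of_def)
  ultimately show ?l
    unfolding digraph_iso_def by blast
qed

end

theory Submission
  imports Defs
begin

text \<open>
  In each of the three graphs all vertices have the same degree, and this degree strictly increases
  with the codimension \<open>c = n - 1 - u\<close> as long as \<open>2 * c \<le> n\<close>; so isomorphic graphs have equal \<open>u\<close>.

  Let \<open>X\<close> have vector space rank \<open>a = n - c\<close>, let \<open>[k]\<close> be the number of points of a singular
  subspace of rank \<open>k\<close>, and let \<open>N r\<close> be the number of \<open>Y \<bottom> X\<close> of rank \<open>a\<close> such that \<open>X \<inter> Y\<close> has
  rank \<open>a - r\<close>.  Counting pairs \<open>(Y, Y')\<close> that meet in a hyperplane, with \<open>Y\<close> counted by \<open>N r\<close> and \<open>Y'\<close>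
  by \<open>N (r + 1)\<close>, gives
  \<open>[r + 1]\<^sup>2 * N (r + 1) = s ^ (2 * r + 1) * [a - r] * [c - r] * (t * s ^ (c - r - 1) + 1) * N r\<close>.
  The right-hand factor increases with \<open>c\<close> when \<open>a + c = n\<close> is fixed, hence so does every \<open>N r\<close>.
  The degrees are the sum of the \<open>N r\<close> over \<open>r > 0\<close> for \<open>\<bottom>\<close>, that sum plus \<open>[a] * t * s ^ (2 * c)\<close>
  for \<open>\<bottom> \<union> \<approx>\<close>, and \<open>N c\<close> for \<open>\<bottom>\<^sub>m\<^sub>a\<^sub>x\<close> (if \<open>c > 0\<close>).

  That singular subspaces are projective spaces is obtained from a separation property: a point
  outside a singular subspace \<open>X\<close> is not collinear with some point of \<open>X\<^sup>\<bottom>\<close>.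
\<close>

subsection \<open>Separation of points from singular subspaces\<close>

lemma geom_span_superset: "A \<subseteq> geom_span P L A"
  by (auto simp: geom_span_def)

lemma geom_span_least: "geom_subspace P L S \<Longrightarrow> A \<subseteq> S \<Longrightarrow> geom_span P L A \<subseteq> S"
  by (auto simp: geom_span_def)

lemma pt_collinear_refl [simp]: "pt_collinear L p p"
  by (simp add: pt_collinear_def)

lemma pt_collinear_sym: "pt_collinear L p q \<Longrightarrow> pt_collinear L q p"
  by (auto simp: pt_collinear_def)

lemma pt_collinear_commute: "pt_collinear L p q \<longleftrightarrow> pt_collinear L q p"
  by (auto simp: pt_collinear_def)

lemma pt_collinearI: "l \<in> L \<Longrightarrow> p \<in> l \<Longrightarrow> q \<in> l \<Longrightarrow> pt_collinear L p q"
  by (auto simp: pt_collinear_def)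

lemma pt_collinearE:
  assumes "pt_collinear L p q" "p \<noteq> q"
  obtains l where "l \<in> L" "p \<in> l" "q \<in> l"
  using assms by (auto simp: pt_collinear_def)

context finite_polar_space
begin

section \<open>Subspaces, spans and collinearity\<close>

lemma geom_subspace_Inter:
  assumes "\<A> \<noteq> {}" "\<And>S. S \<in> \<A> \<Longrightarrow> geom_subspace P L S"
  shows "geom_subspace P L (\<Inter>\<A>)"
  unfolding geom_subspace_def
proof (intro conjI ballI impI)
  show "\<Inter>\<A> \<subseteq> P" using assms by (fastforce simp: geom_subspace_def)
  fix l p q assume "l \<in> L" "p \<in> \<Inter>\<A>" "q \<in> \<Inter>\<A>" "p \<noteq> q \<and> p \<in> l \<and> q \<in> l"
  then show "l \<subseteq> \<Inter>\<A>"
    using assms(2) by (intro Inter_greatest) (meson InterE geom_subspace_def)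
qed

lemma geom_subspace_P: "geom_subspace P L P"
  using line_subset by (auto simp: geom_subspace_def)

lemma geom_subspace_span: "A \<subseteq> P \<Longrightarrow> geom_subspace P L (geom_span P L A)"
  unfolding geom_span_def by (rule geom_subspace_Inter) (use geom_subspace_P in auto)

lemma geom_span_eq: "geom_subspace P L S \<Longrightarrow> geom_span P L S = S"
  by (simp add: geom_span_least geom_span_superset subset_antisym)

lemma subspace_lineD:
  "geom_subspace P L S \<Longrightarrow> l \<in> L \<Longrightarrow> p \<in> S \<Longrightarrow> q \<in> S \<Longrightarrow> p \<noteq> q \<Longrightarrow> p \<in> l \<Longrightarrow> q \<in> l \<Longrightarrow> r \<in> l \<Longrightarrow> r \<in> S"
  unfolding geom_subspace_def by blast

lemma collinear_line:
  assumes "z \<in> P" "l \<in> L" "x \<in> l" "y \<in> l" "x \<noteq> y"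
    and "pt_collinear L z x" "pt_collinear L z y" "w \<in> l"
  shows "pt_collinear L z w"
  using one_or_all[OF assms(1,2)] assms(3-) by blast

lemma line_meets_perp:
  assumes "z \<in> P" "l \<in> L"
  obtains q where "q \<in> l" "pt_collinear L z q"
proof -
  have "l \<noteq> {}" using line_card_ge_3[OF assms(2)] by auto
  then show ?thesis using one_or_all[OF assms] that by blast
qed

text \<open>By one-or-all, a point collinear with two points of a line is collinear with all of it.
  The axiom speaks of points of \<open>P\<close>; the guard \<open>a \<in> P\<close> restricts to
  these, so that \<open>A\<close> can be arbitrary.\<close>

lemma geom_subspace_perp: "geom_subspace P L {z \<in> P. \<forall>a\<in>A. a \<in> P \<longrightarrow> pt_collinear L a z}"
  unfolding geom_subspace_def
proof (intro conjI ballI impI subsetI)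
  fix l p q w
  assume "l \<in> L" "p \<noteq> q \<and> p \<in> l \<and> q \<in> l" "w \<in> l"
    and "p \<in> {z \<in> P. \<forall>a\<in>A. a \<in> P \<longrightarrow> pt_collinear L a z}"
    and "q \<in> {z \<in> P. \<forall>a\<in>A. a \<in> P \<longrightarrow> pt_collinear L a z}"
  then show "w \<in> {z \<in> P. \<forall>a\<in>A. a \<in> P \<longrightarrow> pt_collinear L a z}"
    using line_subset collinear_line[of _ l p q w] by blast
qed simp

lemma collinear_span:
  assumes "z \<in> P" "A \<subseteq> P" "\<forall>a\<in>A. pt_collinear L z a" "w \<in> geom_span P L A"
  shows "pt_collinear L z w"
  using geom_span_least[OF geom_subspace_perp[of "{z}"], of A] assms by auto

text \<open>Collinearity is carried from \<open>A\<close> to the span one argument at a time,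
  because the points collinear with a fixed point form a subspace.\<close>

lemma perp_span_span:
  assumes "A \<subseteq> P" "perp L A A"
  shows "perp L (geom_span P L A) (geom_span P L A)"
proof -
  have sub: "geom_span P L A \<subseteq> P"
    using geom_subspace_span[OF assms(1)] by (simp add: geom_subspace_def)
  have 1: "pt_collinear L a w" if "a \<in> A" "w \<in> geom_span P L A" for a w
    using collinear_span[of a A w] assms that by (auto simp: perp_def)
  show ?thesis
    unfolding perp_def
  proof (intro ballI)
    fix v w assume v: "v \<in> geom_span P L A" and w: "w \<in> geom_span P L A"
    show "pt_collinear L v w"
    proof (rule collinear_span[of v A w])
      show "\<forall>a\<in>A. pt_collinear L v a" using 1[OF _ v] by (simp add: pt_collinear_commute[of L v])
    qed (use v w sub assms in auto)
  qed
qed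

lemma singular_span:
  "A \<subseteq> P \<Longrightarrow> perp L A A \<Longrightarrow> singular_subspace P L (geom_span P L A)"
  by (simp add: singular_subspace_def geom_subspace_span perp_span_span)

text \<open>If \<open>p \<noteq> q\<close>, take \<open>w\<close> not collinear with
  \<open>p\<close> and the point \<open>m\<close> of the line through \<open>p\<close> and
  \<open>q\<close> that is collinear with \<open>w\<close>. Then \<open>m\<close> is collinear with
  every point, against nondegeneracy.\<close>

lemma perp_subset_imp_eq:
  assumes p: "p \<in> P" and q: "q \<in> P"
    and sub: "\<And>z. z \<in> P \<Longrightarrow> pt_collinear L z p \<Longrightarrow> pt_collinear L z q"
  shows "p = q"
proof (rule ccontr)
  assume "p \<noteq> q"
  then obtain l where l: "l \<in> L" "p \<in> l" "q \<in> l"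
    using sub[OF p] by (auto elim: pt_collinearE)
  obtain w where w: "w \<in> P" "\<not> pt_collinear L p w"
    using nondegenerate[OF p] by blast
  obtain m where m: "m \<in> l" "pt_collinear L w m"
    using line_meets_perp[OF w(1) l(1)] .
  have mP: "m \<in> P" using m(1) l(1) line_subset by blast
  have a: "pt_collinear L u m" if "u \<in> P" "pt_collinear L u p" for u
    using collinear_line[OF that(1) l \<open>p \<noteq> q\<close>] that sub m by blast
  \<comment> \<open>Among points not collinear with \<open>p\<close>, collinearity with
    \<open>m\<close> passes from \<open>x\<close> to \<open>v\<close>: the line through them has a
    point \<open>g\<close> collinear with \<open>p\<close>, and both \<open>g\<close> and
    \<open>x\<close> are collinear with \<open>m\<close>.\<close>
  have b: "pt_collinear L v m"
    if v: "v \<in> P" "\<not> pt_collinear L p v" and x: "x \<in> P" "\<not> pt_collinear L p x" "pt_collinear L x m"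
      and vx: "pt_collinear L v x" for v x
  proof (cases "v = x")
    case False
    then obtain k where k: "k \<in> L" "v \<in> k" "x \<in> k" using vx by (auto elim: pt_collinearE)
    obtain g where g: "g \<in> k" "pt_collinear L p g" using line_meets_perp[OF p k(1)] .
    have "pt_collinear L g m"
      using a[OF _ pt_collinear_sym[OF g(2)]] g(1) k(1) line_subset by blast
    moreover have "g \<noteq> x" using g x by blast
    ultimately show ?thesis
      using collinear_line[OF mP k(1) g(1) k(3)] k(2) x(3) by (metis pt_collinear_sym)
  qed (use x in simp)
  have "pt_collinear L v m" if v: "v \<in> P" for v
  proof (cases "pt_collinear L p v")
    case True
    then show ?thesis using a[OF v pt_collinear_sym] by blast
  next
    case False
    \<comment> \<open>Project \<open>v\<close> to a point \<open>v'\<close> of the line through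
      \<open>w\<close> and \<open>m\<close>. Unless \<open>v' = m\<close>, it is not collinear with
      \<open>p\<close>, since otherwise \<open>w\<close> would be; so it passes collinearity with
      \<open>m\<close> on to \<open>v\<close>.\<close>
    have "w \<noteq> m" using w(2) m(1) l by (auto intro: pt_collinearI)
    then obtain k where k: "k \<in> L" "w \<in> k" "m \<in> k" using m(2) by (auto elim: pt_collinearE)
    obtain v' where v': "v' \<in> k" "pt_collinear L v v'" using line_meets_perp[OF v k(1)] .
    show ?thesis
    proof (cases "v' = m")
      case False
      have pm: "pt_collinear L p m" using l m by (auto intro: pt_collinearI)
      have "\<not> pt_collinear L p v'"
        using collinear_line[OF p k(1) v'(1) k(3) False _ pm k(2)] w(2) by blast
      then show ?thesis
        using b[OF v \<open>\<not> pt_collinear L p v\<close>, of v'] v' k line_subset by (blast intro: pt_collinearI)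
    qed (use v' in simp)
  qed
  then show False using nondegenerate[OF mP] by (auto simp: pt_collinear_commute)
qed

lemma pt_collinear_restrict:
  assumes "geom_subspace P L R" "x \<in> R" "y \<in> R"
  shows "pt_collinear {l \<in> L. l \<subseteq> R} x y \<longleftrightarrow> pt_collinear L x y"
proof (cases "x = y")
  case False
  then have "l \<subseteq> R" if "l \<in> L" "x \<in> l" "y \<in> l" for l
    using assms that unfolding geom_subspace_def by blast
  then show ?thesis unfolding pt_collinear_def by blast
qed simp

text \<open>Nondegeneracy is the axiom that needs an argument. Every line through \<open>p\<close>
  has a point collinear with \<open>r\<close>, hence in \<open>R\<close>; so a point
  \<open>x\<close> collinear with all of \<open>R\<close> is collinear with everything that
  \<open>p\<close> is, and \<open>p = x\<close>.\<close>

lemma finite_polar_space_restrict: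
  assumes p: "p \<in> P" and r: "r \<in> P" and pr: "\<not> pt_collinear L p r"
  defines "R \<equiv> {x \<in> P. pt_collinear L p x \<and> pt_collinear L r x}"
  shows "finite_polar_space R {l \<in> L. l \<subseteq> R}" and "geom_subspace P L R"
proof -
  have "R = {z \<in> P. \<forall>a\<in>{p, r}. a \<in> P \<longrightarrow> pt_collinear L a z}"
    using p r by (auto simp: R_def)
  then show R: "geom_subspace P L R" using geom_subspace_perp by metis
  note restr = pt_collinear_restrict[OF R]
  show "finite_polar_space R {l \<in> L. l \<subseteq> R}"
  proof
    show "finite R" using finite_points by (simp add: R_def)
    show "l = m" if "l \<in> {l \<in> L. l \<subseteq> R}" "m \<in> {l \<in> L. l \<subseteq> R}" "x \<noteq> y" "x \<in> l" "y \<in> l" "x \<in> m" "y \<in> m" for l m x y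
      using partial_linear[of l m x y] that by blast
    show "(\<exists>!q. q \<in> l \<and> pt_collinear {l \<in> L. l \<subseteq> R} x q) \<or> (\<forall>q\<in>l. pt_collinear {l \<in> L. l \<subseteq> R} x q)"
      if x: "x \<in> R" and l: "l \<in> {l \<in> L. l \<subseteq> R}" for x l
    proof -
      have "pt_collinear {l \<in> L. l \<subseteq> R} x q \<longleftrightarrow> pt_collinear L x q" if "q \<in> l" for q
        using restr x l that by blast
      then show ?thesis using one_or_all[of x l] x l by (auto simp: R_def)
    qed
    show "\<exists>y\<in>R. \<not> pt_collinear {l \<in> L. l \<subseteq> R} x y" if x: "x \<in> R" for x
    proof (rule ccontr)
      assume "\<not> ?thesis"
      then have all: "pt_collinear L x y" if "y \<in> R" for y using restr[OF x that] that by blast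
      have xP: "x \<in> P" and px: "pt_collinear L p x" using x by (auto simp: R_def)
      have "p = x"
      proof (rule perp_subset_imp_eq[OF p xP])
        fix z assume z: "z \<in> P" "pt_collinear L z p"
        show "pt_collinear L z x"
        proof (cases "z = p")
          case False
          then obtain l where l: "l \<in> L" "z \<in> l" "p \<in> l" using z by (auto elim: pt_collinearE)
          obtain y where y: "y \<in> l" "pt_collinear L r y" using line_meets_perp[OF r l(1)] .
          have "y \<in> R" using y l line_subset by (auto simp: R_def intro: pt_collinearI)
          then have "pt_collinear L x y" by (rule all)
          moreover have "y \<noteq> p" using y pr by (auto simp: pt_collinear_commute)
          ultimately show ?thesis
            using collinear_line[OF xP l(1) y(1) l(3) _ _ pt_collinear_sym[OF px] l(2)]
            by (blast intro: pt_collinear_sym)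
        qed (use px in simp)
      qed
      then show False using x pr by (auto simp: R_def pt_collinear_commute)
    qed
  qed (use line_card_ge_3 in auto)
qed

end

text \<open>
  Induction on the size of \<open>A\<close>: for \<open>y \<in> A\<close> and \<open>w\<close> not collinear with \<open>y\<close>, project everything from
  \<open>y\<close> into the polar space formed by the points collinear with both \<open>y\<close> and \<open>w\<close>.
\<close>

lemma singular_separation:
  assumes "finite A" "finite_polar_space P L" "A \<subseteq> P" "perp L A A" "p \<in> P" "p \<notin> geom_span P L A"
  shows "\<exists>r\<in>P. (\<forall>a\<in>A. pt_collinear L r a) \<and> \<not> pt_collinear L r p"
  using assms
proof (induction "card A" arbitrary: A P L p rule: less_induct)
  case less
  interpret finite_polar_space P L by (rule less.prems(2))
  show ?case
  proof (cases "A = {} \<or> (\<exists>a\<in>A. \<not> pt_collinear L a p)")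
    case True
    then show ?thesis
    proof
      assume "A = {}"
      then show ?thesis using nondegenerate[OF less.prems(5)] by (auto simp: pt_collinear_commute)
    qed (use less.prems(3,4) in \<open>auto simp: perp_def\<close>)
  next
    case False
    then obtain y where y: "y \<in> A" by blast
    have yP: "y \<in> P" using y less.prems(3) by blast
    obtain w where w: "w \<in> P" "\<not> pt_collinear L y w" using nondegenerate[OF yP] by blast
    define R where "R = {x \<in> P. pt_collinear L y x \<and> pt_collinear L w x}"
    have pol: "finite_polar_space R {l \<in> L. l \<subseteq> R}" and R: "geom_subspace P L R"
      using finite_polar_space_restrict[OF yP w] unfolding R_def by blast+
    note restr = pt_collinear_restrict[OF R]
    \<comment> \<open>\<open>x'\<close> is the projection of \<open>x\<close> from \<open>y\<close>:
      the point of their line that is collinear with \<open>w\<close>.\<close>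
    have "\<exists>x'. x' \<in> R \<and> x' \<noteq> y \<and> (\<exists>l\<in>L. x \<in> l \<and> y \<in> l \<and> x' \<in> l)"
      if x: "x \<in> P" "x \<noteq> y" "pt_collinear L x y" for x
    proof -
      obtain l where l: "l \<in> L" "x \<in> l" "y \<in> l" using x by (auto elim: pt_collinearE)
      obtain x' where x': "x' \<in> l" "pt_collinear L w x'" using line_meets_perp[OF w(1) l(1)] .
      have "x' \<in> R" using x' l line_subset by (auto simp: R_def intro: pt_collinearI)
      moreover have "x' \<noteq> y" using x' w by (auto simp: pt_collinear_commute)
      ultimately show ?thesis using l x' by blast
    qed
    then obtain g where g: "\<And>x. x \<in> P \<Longrightarrow> x \<noteq> y \<Longrightarrow> pt_collinear L x y \<Longrightarrow>
        g x \<in> R \<and> g x \<noteq> y \<and> (\<exists>l\<in>L. x \<in> l \<and> y \<in> l \<and> g x \<in> l)" by metis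
    define B where "B = A - {y}"
    have gB: "g x \<in> R \<and> g x \<noteq> y \<and> (\<exists>l\<in>L. x \<in> l \<and> y \<in> l \<and> g x \<in> l)" if "x \<in> B" for x
      using g[of x] that y less.prems(3,4) by (auto simp: B_def perp_def)
    have A_span: "A \<subseteq> geom_span P L A" by (rule geom_span_superset)
    have "p \<noteq> y" using y less.prems(6) A_span by blast
    moreover have "pt_collinear L p y" using False y by (simp add: pt_collinear_commute[of L p])
    ultimately have gp: "g p \<in> R" "g p \<noteq> y" and "\<exists>l\<in>L. p \<in> l \<and> y \<in> l \<and> g p \<in> l"
      using g less.prems(5) by blast+
    then obtain k where k: "k \<in> L" "p \<in> k" "y \<in> k" "g p \<in> k" by blast
    have span: "geom_subspace P L (geom_span P L A)" using geom_subspace_span less.prems(3) .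
    have g_span: "g x \<in> geom_span P L A" if "x \<in> B" for x
      using gB[OF that] subspace_lineD[OF span, of _ x y "g x"] that y A_span
      by (auto simp: B_def)
    have "\<exists>r\<in>R. (\<forall>a\<in>g ` B. pt_collinear {l \<in> L. l \<subseteq> R} r a) \<and> \<not> pt_collinear {l \<in> L. l \<subseteq> R} r (g p)"
    proof (rule less.hyps)
      have "card (g ` B) \<le> card B" using less.prems(1) by (auto simp: B_def intro: card_image_le)
      also have "card B < card A" unfolding B_def by (rule card_Diff1_less[OF less.prems(1) y])
      finally show "card (g ` B) < card A" .
      show "finite (g ` B)" using less.prems(1) by (simp add: B_def)
      show gBR: "g ` B \<subseteq> R" using gB by blast
      show "perp {l \<in> L. l \<subseteq> R} (g ` B) (g ` B)"
        unfolding perp_def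
      proof (intro ballI)
        fix u v assume uv: "u \<in> g ` B" "v \<in> g ` B"
        then have "u \<in> geom_span P L A" "v \<in> geom_span P L A" using g_span by blast+
        then have "pt_collinear L u v"
          using perp_span_span[OF less.prems(3,4)] by (simp add: perp_def)
        then show "pt_collinear {l \<in> L. l \<subseteq> R} u v" using restr[of u v] uv gBR by blast
      qed
      show "g p \<in> R" by (rule gp)
      \<comment> \<open>The span taken inside \<open>R\<close> lies in the span of \<open>A\<close>.
        If it contained \<open>g p\<close>, the span of \<open>A\<close> would contain the line
        through \<open>y\<close> and \<open>g p\<close>, hence \<open>p\<close>.\<close>
      show "g p \<notin> geom_span R {l \<in> L. l \<subseteq> R} (g ` B)"
      proof
        assume "g p \<in> geom_span R {l \<in> L. l \<subseteq> R} (g ` B)"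
        moreover have "geom_subspace R {l \<in> L. l \<subseteq> R} (R \<inter> geom_span P L A)"
          using span unfolding geom_subspace_def by blast
        ultimately have "g p \<in> geom_span P L A"
          using geom_span_least[of R "{l \<in> L. l \<subseteq> R}" "R \<inter> geom_span P L A" "g ` B"] gBR g_span by blast
        then have "p \<in> geom_span P L A"
          using subspace_lineD[OF span k(1) _ _ gp(2) k(4,3,2)] y A_span by blast
        then show False using less.prems(6) by blast
      qed
    qed (rule pol)
    then obtain r where r0: "r \<in> R" "\<forall>a\<in>g ` B. pt_collinear {l \<in> L. l \<subseteq> R} r a"
      "\<not> pt_collinear {l \<in> L. l \<subseteq> R} r (g p)" by blast
    have r: "r \<in> R" "\<And>x. x \<in> B \<Longrightarrow> pt_collinear L r (g x)" "\<not> pt_collinear L r (g p)"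
      using r0 restr[OF r0(1)] gB gp(1) by simp_all
    have rP: "r \<in> P" and ry: "pt_collinear L r y" using r(1) by (auto simp: R_def intro: pt_collinear_sym)
    \<comment> \<open>Since \<open>r\<close> is collinear with \<open>y\<close>, it is collinear
      with another point of a line through \<open>y\<close> iff it is collinear with the projection
      of that point.\<close>
    have "pt_collinear L r a" if "a \<in> A" for a
    proof (cases "a = y")
      case False
      then have aB: "a \<in> B" using that by (simp add: B_def)
      then obtain l where l: "l \<in> L" "a \<in> l" "y \<in> l" "g a \<in> l" using gB by blast
      show ?thesis
        using collinear_line[OF rP l(1) l(4) l(3) _ r(2)[OF aB] ry l(2)] gB[OF aB] by blast
    qed (use ry in simp)
    moreover have "\<not> pt_collinear L r p"
      using collinear_line[OF rP k(1,2,3) \<open>p \<noteq> y\<close> _ ry k(4)] r(3) by blast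
    ultimately show ?thesis using rP by blast
  qed
qed

subsection \<open>Gaussian numbers and counting by fibres\<close>

text \<open>The Gaussian number \<open>(s ^ k - 1) / (s - 1)\<close>, written \<open>[k]\<close>
  above. The recursion is the form in which it arises: a cone consists of its apex and
  \<open>s\<close> points for each point of its base.\<close>

primrec qnum :: "nat \<Rightarrow> nat \<Rightarrow> nat" where
  "qnum s 0 = 0"
| "qnum s (Suc k) = Suc (s * qnum s k)"

lemma qnum_less: "k < m \<Longrightarrow> 0 < s \<Longrightarrow> qnum s k < qnum s m"
proof (induction m arbitrary: k)
  case (Suc m)
  then show ?case by (cases k) auto
qed simp

lemma qnum_less_iff: "0 < s \<Longrightarrow> qnum s k < qnum s m \<longleftrightarrow> k < m"
  by (metis linorder_neqE_nat not_less_iff_gr_or_eq qnum_less)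

lemma qnum_le_iff: "0 < s \<Longrightarrow> qnum s k \<le> qnum s m \<longleftrightarrow> k \<le> m"
  by (metis linorder_not_less qnum_less_iff)

lemma qnum_eq_iff: "0 < s \<Longrightarrow> qnum s k = qnum s m \<longleftrightarrow> k = m"
  by (metis linorder_neqE_nat nat_neq_iff qnum_less)

lemma qnum_add: "qnum s (k + m) = qnum s k + s ^ k * qnum s m"
  by (induction k) (auto simp: algebra_simps)

lemma card_by_fibres:
  assumes "finite A" "finite B" "\<And>a. a \<in> A \<Longrightarrow> g a \<in> B"
    and "\<And>b. b \<in> B \<Longrightarrow> card {a \<in> A. g a = b} = k"
  shows "card A = k * card B"
proof -
  have "card A = (\<Sum>a\<in>A. card {b \<in> B. g a = b})"
  proof -
    have "{b \<in> B. g a = b} = {g a}" if "a \<in> A" for a using assms(3)[OF that] by blast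
    then show ?thesis by simp
  qed
  also have "\<dots> = k * card B"
    by (rule sum_multicount) (use assms in auto)
  finally show ?thesis .
qed

text \<open>Expanded, both sides share \<open>s * [x] * [y]\<close>, and
  \<open>[y] \<le> [x]\<close> remains. So the product grows as the two ranks get closer.\<close>

lemma qnum_Suc_mult_le: "0 < s \<Longrightarrow> y \<le> x \<Longrightarrow> qnum s (Suc x) * qnum s y \<le> qnum s x * qnum s (Suc y)"
  using qnum_le_iff[of s y x] by (simp add: algebra_simps)

lemma qnum_Suc_less: "1 < s \<Longrightarrow> qnum s (Suc r) < 2 * s ^ r"
proof (induction r)
  case (Suc r)
  then have "s * (qnum s (Suc r) + 1) \<le> s * (2 * s ^ r)" by (intro mult_le_mono2) simp
  then show ?case using Suc.prems by (simp add: algebra_simps)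
qed simp

text \<open>Each increment of the rank multiplies \<open>[k]\<close> by at most
  \<open>s + 1 \<le> s ^ 2\<close>. This weighs \<open>[a]\<close> against
  \<open>s ^ (2 * c)\<close> in the degree for \<open>\<bottom> \<union> \<approx>\<close>.\<close>

lemma qnum_add_le: "1 < s \<Longrightarrow> 0 < k \<Longrightarrow> qnum s (k + d) \<le> s ^ (2 * d) * qnum s k"
proof (induction d)
  case (Suc d)
  have "0 < qnum s (k + d)" using Suc.prems qnum_less[of 0 "k + d" s] by simp
  then have "qnum s (k + Suc d) \<le> (1 + s) * qnum s (k + d)" by (simp add: algebra_simps)
  also have "\<dots> \<le> (s * s) * qnum s (k + d)"
  proof (rule mult_le_mono1)
    have "2 * s \<le> s * s" using Suc.prems by (intro mult_le_mono1) simp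
    then show "1 + s \<le> s * s" using Suc.prems(1) by linarith
  qed
  also have "\<dots> \<le> (s * s) * (s ^ (2 * d) * qnum s k)" using Suc by (intro mult_le_mono2) simp
  finally show ?case by (simp add: algebra_simps)
qed simp

subsection \<open>Singular subspaces as projective spaces\<close>

locale polar_space_of_order = finite_polar_space P L
  for P :: "'a set" and L :: "'a set set" +
  fixes n s t :: nat
  assumes polar_rank: "has_polar_rank P L n" and polar_order: "has_polar_order P L n s t"
begin

abbreviation "sing \<equiv> singular_subspace P L"
abbreviation "pspan \<equiv> geom_span P L"

lemma s_gt_1: "1 < s" and s_pos: "0 < s" and t_pos: "0 < t"
  and card_line: "l \<in> L \<Longrightarrow> card l = s + 1"
  using polar_order by (auto simp: has_polar_order_def)

lemma sing_subset: "sing X \<Longrightarrow> X \<subseteq> P"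
  by (simp add: singular_subspace_def geom_subspace_def)

lemma finite_sing_pts: "sing X \<Longrightarrow> finite X"
  using sing_subset finite_points finite_subset by blast

lemma finite_sing: "finite {X. sing X \<and> Q X}"
  by (rule finite_subset[of _ "Pow P"]) (use sing_subset finite_points in auto)

lemma sing_subspace: "sing X \<Longrightarrow> geom_subspace P L X"
  by (simp add: singular_subspace_def)

lemma sing_perp: "sing Z \<Longrightarrow> X \<subseteq> Z \<Longrightarrow> Y \<subseteq> Z \<Longrightarrow> perp L X Y"
  unfolding singular_subspace_def perp_def by blast

lemma perp_sym: "perp L X Y \<Longrightarrow> perp L Y X"
  unfolding perp_def by (auto intro: pt_collinear_sym)

lemma perp_mono: "perp L X Y \<Longrightarrow> X' \<subseteq> X \<Longrightarrow> Y' \<subseteq> Y \<Longrightarrow> perp L X' Y'"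
  unfolding perp_def by blast

lemma subspace_Int: "geom_subspace P L X \<Longrightarrow> geom_subspace P L Y \<Longrightarrow> geom_subspace P L (X \<inter> Y)"
  using geom_subspace_Inter[of "{X, Y}"] by auto

lemma sing_Int: "sing X \<Longrightarrow> sing Y \<Longrightarrow> sing (X \<inter> Y)"
  by (simp add: singular_subspace_def subspace_Int) (auto simp: perp_def)

lemma sing_empty: "sing {}"
  by (simp add: singular_subspace_def geom_subspace_def perp_def)

lemma sing_lineE:
  assumes "sing X" "p \<in> X" "q \<in> X" "p \<noteq> q"
  obtains l where "l \<in> L" "p \<in> l" "q \<in> l" "l \<subseteq> X"
proof -
  have "pt_collinear L p q" using assms by (simp add: singular_subspace_def perp_def)
  then obtain l where l: "l \<in> L" "p \<in> l" "q \<in> l" using assms(4) by (rule pt_collinearE)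
  then have "l \<subseteq> X" using subspace_lineD[OF sing_subspace[OF assms(1)], of l p q] assms by blast
  then show ?thesis using l that by blast
qed

lemma span_mono: "A \<subseteq> B \<Longrightarrow> pspan A \<subseteq> pspan B"
  by (auto simp: geom_span_def)

lemma span_least: "sing S \<Longrightarrow> A \<subseteq> S \<Longrightarrow> pspan A \<subseteq> S"
  by (rule geom_span_least[OF sing_subspace])

lemma span_Un_span:
  assumes "A \<subseteq> P" "B \<subseteq> P" shows "pspan (A \<union> pspan B) = pspan (A \<union> B)"
proof
  show "pspan (A \<union> pspan B) \<subseteq> pspan (A \<union> B)"
  proof (rule geom_span_least)
    show "geom_subspace P L (pspan (A \<union> B))" using assms by (simp add: geom_subspace_span)
    show "A \<union> pspan B \<subseteq> pspan (A \<union> B)"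
      using geom_span_superset[of "A \<union> B" P L] span_mono[of B "A \<union> B"] by blast
  qed
  show "pspan (A \<union> B) \<subseteq> pspan (A \<union> pspan B)"
    by (rule span_mono) (use geom_span_superset[of B P L] in blast)
qed

lemma span_insert_span: "a \<in> P \<Longrightarrow> B \<subseteq> P \<Longrightarrow> pspan (insert a (pspan B)) = pspan (insert a B)"
  using span_Un_span[of "{a}" B] by simp

text \<open>The lines joining \<open>p\<close> to the points of \<open>X\<close> partition
  \<open>S - {p}\<close> into sets of size \<open>s\<close>: two points of \<open>X\<close> on one
  such line would put \<open>p\<close> into \<open>X\<close>.\<close>

lemma cone_card:
  assumes S: "sing S" and X: "sing X" "X \<subseteq> S" and p: "p \<in> S" "p \<notin> X"
    and meet: "\<And>q. q \<in> S \<Longrightarrow> q \<noteq> p \<Longrightarrow> \<exists>x\<in>X. \<exists>l\<in>L. p \<in> l \<and> q \<in> l \<and> x \<in> l"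
  shows "card S = Suc (s * card X)"
proof -
  have "\<exists>l. l \<in> L \<and> p \<in> l \<and> x \<in> l \<and> l \<subseteq> S" if "x \<in> X" for x
    using sing_lineE[OF S p(1), of x] that X p by blast
  then obtain f where f: "\<And>x. x \<in> X \<Longrightarrow> f x \<in> L \<and> p \<in> f x \<and> x \<in> f x \<and> f x \<subseteq> S" by metis
  have f_eq: "f x = l" if "x \<in> X" "l \<in> L" "p \<in> l" "x \<in> l" for x l
    using partial_linear[of "f x" l p x] f[OF that(1)] that p by blast
  have eq: "S - {p} = (\<Union>x\<in>X. f x - {p})"
  proof (intro equalityI subsetI)
    fix q assume q: "q \<in> S - {p}"
    then obtain x l where "x \<in> X" "l \<in> L" "p \<in> l" "q \<in> l" "x \<in> l" using meet by blast
    then show "q \<in> (\<Union>x\<in>X. f x - {p})" using f_eq q by blast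
  qed (use f in blast)
  have disj: "(f x - {p}) \<inter> (f y - {p}) = {}" if xy: "x \<in> X" "y \<in> X" "x \<noteq> y" for x y
  proof (rule ccontr)
    assume "\<not> ?thesis"
    then obtain q where q: "q \<in> f x" "q \<in> f y" "q \<noteq> p" by blast
    then have "f x = f y" using partial_linear[of "f x" "f y" p q] f xy by blast
    then have "p \<in> X"
      using subspace_lineD[OF sing_subspace[OF X(1)], of "f x" x y p] f xy by metis
    then show False using p by blast
  qed
  have "card (S - {p}) = (\<Sum>x\<in>X. card (f x - {p}))"
    unfolding eq
  proof (rule card_UN_disjoint)
    show "finite X" by (rule finite_sing_pts[OF X(1)])
    show "\<forall>x\<in>X. finite (f x - {p})"
      using f finite_subset[OF _ finite_sing_pts[OF S]] by blast
  qed (use disj in blast)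
  also have "\<dots> = (\<Sum>x\<in>X. s)"
  proof (rule sum.cong)
    fix x assume "x \<in> X"
    then show "card (f x - {p}) = s" using f[of x] card_line[of "f x"] by (simp add: card_Diff_singleton)
  qed simp
  also have "\<dots> = s * card X" by simp
  finally show ?thesis
    using card.remove[OF finite_sing_pts[OF S] p(1)] by simp
qed

lemma sing_span_insert:
  assumes "sing X" "p \<in> P" "\<forall>x\<in>X. pt_collinear L p x"
  shows "sing (pspan (insert p X))"
proof (rule singular_span)
  show "insert p X \<subseteq> P" using assms sing_subset by blast
  have "pt_collinear L u v" if "u \<in> X" "v \<in> X" for u v
    using assms(1) that by (simp add: singular_subspace_def perp_def)
  then show "perp L (insert p X) (insert p X)"
    using assms(3) pt_collinear_sym[of L p] by (auto simp: perp_def)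
qed

text \<open>
  Separate \<open>p\<close> from \<open>X\<close> by some \<open>z\<close>.  Within the span of \<open>p\<close> and \<open>X\<close>, only points of \<open>X\<close> are collinear
  with \<open>z\<close>: another such point \<open>e\<close> could be separated from \<open>X\<close> by a point collinear with \<open>p\<close> and \<open>z\<close>,
  which is then collinear with the whole span and so with \<open>e\<close>.
\<close>

lemma cone_over_sing:
  assumes X: "sing X" and p: "p \<in> P" "p \<notin> X" "\<forall>x\<in>X. pt_collinear L p x"
  shows cone_lines: "q \<in> pspan (insert p X) \<Longrightarrow> q \<noteq> p \<Longrightarrow> \<exists>x\<in>X. \<exists>l\<in>L. p \<in> l \<and> q \<in> l \<and> x \<in> l"
    and card_cone: "card (pspan (insert p X)) = Suc (s * card X)"
proof -
  define S where "S = pspan (insert p X)"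
  have S: "sing S" unfolding S_def by (rule sing_span_insert[OF X p(1,3)])
  have XS: "X \<subseteq> S" and pS: "p \<in> S" using geom_span_superset[of "insert p X" P L] by (auto simp: S_def)
  have XP: "X \<subseteq> P" by (rule sing_subset[OF X])
  have pX: "perp L X X" using X by (simp add: singular_subspace_def)
  have "\<exists>z\<in>P. (\<forall>a\<in>X. pt_collinear L z a) \<and> \<not> pt_collinear L z p"
    by (rule singular_separation[OF finite_sing_pts[OF X] finite_polar_space_axioms XP pX p(1)])
      (simp add: geom_span_eq[OF sing_subspace[OF X]] p(2))
  then obtain z where z: "z \<in> P" "\<And>a. a \<in> X \<Longrightarrow> pt_collinear L z a" "\<not> pt_collinear L p z"
    by (auto simp: pt_collinear_commute[of L p])
  define R where "R = {x \<in> P. pt_collinear L p x \<and> pt_collinear L z x}"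
  have pol: "finite_polar_space R {l \<in> L. l \<subseteq> R}" and R: "geom_subspace P L R"
    using finite_polar_space_restrict[OF p(1) z(1,3)] unfolding R_def by blast+
  note restr = pt_collinear_restrict[OF R]
  have XR: "X \<subseteq> R" using XP p z by (auto simp: R_def)
  have zX: "e \<in> X" if e: "e \<in> S" "pt_collinear L z e" for e
  proof (rule ccontr)
    assume "e \<notin> X"
    have pe: "pt_collinear L p e" using S pS e by (simp add: singular_subspace_def perp_def)
    then have eR: "e \<in> R" using e sing_subset[OF S] by (auto simp: R_def)
    have spX: "geom_span R {l \<in> L. l \<subseteq> R} X \<subseteq> X"
      by (rule geom_span_least) (use sing_subspace[OF X] XR in \<open>auto simp: geom_subspace_def\<close>)
    have "perp {l \<in> L. l \<subseteq> R} X X"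
      using pX XR restr unfolding perp_def by blast
    then have "\<exists>r\<in>R. (\<forall>a\<in>X. pt_collinear {l \<in> L. l \<subseteq> R} r a) \<and> \<not> pt_collinear {l \<in> L. l \<subseteq> R} r e"
      using spX \<open>e \<notin> X\<close> by (intro singular_separation[OF finite_sing_pts[OF X] pol XR _ eR]) auto
    then obtain r where r: "r \<in> R" "\<forall>a\<in>X. pt_collinear L r a" "\<not> pt_collinear L r e"
      using restr XR eR by (metis subsetD)
    have "pt_collinear L r e"
    proof (rule collinear_span)
      show "\<forall>a\<in>insert p X. pt_collinear L r a"
        using r by (auto simp: R_def pt_collinear_commute[of L r])
    qed (use r XP p e in \<open>auto simp: R_def S_def\<close>)
    then show False using r by blast
  qed
  have lines: "\<exists>x\<in>X. \<exists>l\<in>L. p \<in> l \<and> q \<in> l \<and> x \<in> l" if q: "q \<in> S" "q \<noteq> p" for q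
  proof -
    obtain l where l: "l \<in> L" "p \<in> l" "q \<in> l" "l \<subseteq> S" using sing_lineE[OF S pS, of q] q by blast
    obtain x where "x \<in> l" "pt_collinear L z x" using line_meets_perp[OF z(1) l(1)] .
    then show ?thesis using zX l by blast
  qed
  then show "q \<in> pspan (insert p X) \<Longrightarrow> q \<noteq> p \<Longrightarrow> \<exists>x\<in>X. \<exists>l\<in>L. p \<in> l \<and> q \<in> l \<and> x \<in> l"
    by (simp add: S_def)
  show "card (pspan (insert p X)) = Suc (s * card X)"
    using cone_card[OF S X XS pS p(2) lines] by (simp add: S_def)
qed

text \<open>The points of \<open>A\<close> are adjoined one at a time; a point already in the span
  is dropped, any other makes the new span a cone over the old one.\<close>

lemma span_basis:
  assumes "finite A" "A \<subseteq> P" "perp L A A"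
  shows "\<exists>B\<subseteq>A. pspan B = pspan A \<and> card (pspan A) = qnum s (card B)"
  using assms
proof (induction A rule: finite_induct)
  case empty
  have "pspan {} = {}" using span_least[OF sing_empty] by blast
  then show ?case by simp
next
  case (insert a A)
  have AP: "A \<subseteq> P" "a \<in> P" and AA: "perp L A A"
    using insert.prems by (auto intro: perp_mono)
  then obtain B where B: "B \<subseteq> A" "pspan B = pspan A" "card (pspan A) = qnum s (card B)"
    using insert.IH by blast
  have ia: "pspan (insert a A) = pspan (insert a (pspan A))"
    using span_insert_span[OF AP(2,1)] by simp
  show ?case
  proof (cases "a \<in> pspan A")
    case True
    then have "pspan (insert a A) = pspan A"
      using ia geom_span_eq[OF geom_subspace_span[OF AP(1)]] by (simp add: insert_absorb)
    then show ?thesis using B by auto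
  next
    case False
    have S: "sing (pspan A)" using AP AA singular_span by blast
    have "\<forall>x\<in>pspan A. pt_collinear L a x"
      using collinear_span[OF AP(2,1)] insert.prems(2) by (auto simp: perp_def)
    then have "card (pspan (insert a A)) = Suc (s * card (pspan A))"
      unfolding ia by (rule card_cone[OF S AP(2) False])
    moreover have "a \<notin> B" using B(1) insert.hyps by blast
    moreover have "finite B" using B(1) insert.hyps finite_subset by blast
    moreover have "pspan (insert a B) = pspan (insert a A)"
      using span_insert_span[OF AP(2), of B] B AP ia by auto
    ultimately have "insert a B \<subseteq> insert a A \<and> pspan (insert a B) = pspan (insert a A) \<and>
        card (pspan (insert a A)) = qnum s (card (insert a B))" using B by auto
    then show ?thesis by blast
  qed
qed

section \<open>The rank of a singular subspace\<close>

definition rk :: "'a set \<Rightarrow> nat" where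
  "rk X = nat (proj_dim P L X + 1)"

text \<open>The truncation by \<open>nat\<close> in \<open>rk\<close> loses nothing, because
  \<open>proj_dim\<close> is at least \<open>-1\<close>.\<close>

lemma proj_dim_eq: "proj_dim P L X = int (rk X) - 1"
  by (simp add: rk_def proj_dim_def)

text \<open>By \<open>span_basis\<close>, every generating set contains one whose size
  \<open>k\<close> satisfies \<open>card X = [k]\<close>. As \<open>qnum s\<close> is injective,
  \<open>k\<close> is always the same and hence the least size. Ranks can thus be compared through
  cardinalities.\<close>

lemma card_sing:
  assumes "sing X" shows "card X = qnum s (rk X)"
proof -
  have X: "finite X" "X \<subseteq> P" "perp L X X" "pspan X = X"
    using assms finite_sing_pts sing_subset geom_span_eq[OF sing_subspace]
    by (auto simp: singular_subspace_def)
  then obtain B where B: "B \<subseteq> X" "pspan B = X" "card X = qnum s (card B)"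
    using span_basis by metis
  have "(LEAST k. \<exists>A. A \<subseteq> X \<and> finite A \<and> card A = k \<and> pspan A = X) = card B"
  proof (rule Least_equality)
    show "\<exists>A\<subseteq>X. finite A \<and> card A = card B \<and> pspan A = X"
      using B X finite_subset by blast
    fix k assume "\<exists>A\<subseteq>X. finite A \<and> card A = k \<and> pspan A = X"
    then obtain A where A: "A \<subseteq> X" "finite A" "card A = k" "pspan A = X" by blast
    then obtain C where "C \<subseteq> A" "card X = qnum s (card C)"
      using span_basis[of A] X perp_mono[OF X(3)] by auto
    then show "card B \<le> k"
      using B(3) A(2,3) qnum_eq_iff[OF s_pos] card_mono by metis
  qed
  then show ?thesis using B(3) by (simp add: rk_def proj_dim_def)
qed

lemma rk_mono: "sing X \<Longrightarrow> sing Y \<Longrightarrow> X \<subseteq> Y \<Longrightarrow> rk X \<le> rk Y"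
  using card_sing card_mono[OF finite_sing_pts] qnum_le_iff[OF s_pos] by metis

lemma rk_subset_eq: "sing X \<Longrightarrow> sing Y \<Longrightarrow> X \<subseteq> Y \<Longrightarrow> rk Y \<le> rk X \<Longrightarrow> X = Y"
  by (metis card_seteq card_sing finite_sing_pts qnum_le_iff s_pos)

lemma rk_empty [simp]: "rk {} = 0"
  using card_sing[OF sing_empty] by (cases "rk {}") auto

lemma rk_span_insert:
  assumes "sing X" "p \<in> P" "p \<notin> X" "\<forall>x\<in>X. pt_collinear L p x"
  shows "rk (pspan (insert p X)) = Suc (rk X)"
proof -
  have "qnum s (rk (pspan (insert p X))) = qnum s (Suc (rk X))"
    using card_cone[OF assms] card_sing assms(1) card_sing[OF sing_span_insert[OF assms(1,2,4)]] by simp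
  then show ?thesis using qnum_eq_iff[OF s_pos] by blast
qed

lemma sing_collinear: "sing X \<Longrightarrow> x \<in> X \<Longrightarrow> y \<in> X \<Longrightarrow> pt_collinear L x y"
  by (simp add: singular_subspace_def perp_def)

lemma rk_span_insert_sub:
  assumes "sing Y" "sing X" "X \<subseteq> Y" "p \<in> Y" "p \<notin> X"
  shows "sing (pspan (insert p X))" "rk (pspan (insert p X)) = Suc (rk X)" "pspan (insert p X) \<subseteq> Y"
    "insert p X \<subseteq> pspan (insert p X)"
proof -
  have p: "p \<in> P" "\<forall>x\<in>X. pt_collinear L p x"
    using assms sing_subset sing_collinear[OF assms(1)] by blast+
  show "sing (pspan (insert p X))" by (rule sing_span_insert[OF assms(2) p])
  show "rk (pspan (insert p X)) = Suc (rk X)" by (rule rk_span_insert[OF assms(2) p(1) assms(5) p(2)])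
  show "pspan (insert p X) \<subseteq> Y" using assms by (intro span_least) auto
  show "insert p X \<subseteq> pspan (insert p X)" by (rule geom_span_superset)
qed

text \<open>\<open>H\<close> is a maximal proper singular subspace of \<open>Y\<close> above
  \<open>X\<close>, so any point of \<open>Y\<close> outside \<open>H\<close> generates
  \<open>Y\<close> together with it.\<close>

lemma hyperplane_between:
  assumes Y: "sing Y" and X: "sing X" "X \<subset> Y"
  obtains H p where "sing H" "X \<subseteq> H" "H \<subseteq> Y" "p \<in> Y" "p \<notin> H" "Y = pspan (insert p H)" "rk Y = Suc (rk H)"
proof -
  let ?F = "{H. sing H \<and> X \<subseteq> H \<and> H \<subset> Y}"
  have "finite ?F" by (rule finite_sing)
  moreover have "?F \<noteq> {}" using X by blast
  ultimately have "\<exists>H\<in>?F. \<forall>K\<in>?F. H \<subseteq> K \<longrightarrow> H = K" by (rule finite_has_maximal)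
  then obtain H where H: "H \<in> ?F" and max: "\<forall>K\<in>?F. H \<subseteq> K \<longrightarrow> H = K" by (rule bexE)
  then obtain p where p: "p \<in> Y" "p \<notin> H" by blast
  have sub: "sing H" "H \<subseteq> Y" using H by blast+
  note * = rk_span_insert_sub[OF Y sub p]
  have "pspan (insert p H) = Y"
  proof (rule ccontr)
    assume "pspan (insert p H) \<noteq> Y"
    then have "pspan (insert p H) \<in> ?F" using * H by blast
    then have "H = pspan (insert p H)" using bspec[OF max] *(4) by simp
    then show False using *(4) p(2) by (metis insertI1 subsetD)
  qed
  then have "Y = pspan (insert p H)" "rk Y = Suc (rk H)" using *(2) by simp_all
  then show ?thesis using that[OF sub(1) _ sub(2) p] H by blast
qed

lemma rank_between:
  assumes Y: "sing Y" and X: "sing X" "X \<subseteq> Y" and k: "rk X \<le> k" "k \<le> rk Y"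
  shows "\<exists>Z. sing Z \<and> X \<subseteq> Z \<and> Z \<subseteq> Y \<and> rk Z = k"
  using assms
proof (induction "rk Y" arbitrary: Y)
  case 0
  then show ?case by (intro exI[of _ X]) simp
next
  case (Suc m)
  show ?case
  proof (cases "k = rk Y")
    case False
    then have "X \<subset> Y" using Suc.prems by auto
    then obtain H p where H: "sing H" "X \<subseteq> H" "H \<subseteq> Y" "rk Y = Suc (rk H)"
      using hyperplane_between[OF Suc.prems(1,2)] by metis
    then have "\<exists>Z. sing Z \<and> X \<subseteq> Z \<and> Z \<subseteq> H \<and> rk Z = k"
      using Suc.hyps(2) Suc.prems False by (intro Suc.hyps(1)) auto
    then show ?thesis using H by blast
  qed (use Suc.prems in blast)
qed

section \<open>Joins and the modular law\<close>

definition join :: "'a set \<Rightarrow> 'a set \<Rightarrow> 'a set" where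
  "join X Y = pspan (X \<union> Y)"

lemma join_upper: "X \<subseteq> join X Y" "Y \<subseteq> join X Y"
  using geom_span_superset[of "X \<union> Y" P L] by (auto simp: join_def)

lemma join_least: "sing Z \<Longrightarrow> X \<subseteq> Z \<Longrightarrow> Y \<subseteq> Z \<Longrightarrow> join X Y \<subseteq> Z"
  unfolding join_def by (rule span_least) auto

lemma sing_join:
  assumes "sing X" "sing Y" "perp L X Y"
  shows "sing (join X Y)"
  unfolding join_def
proof (rule singular_span)
  show "X \<union> Y \<subseteq> P" using assms sing_subset by blast
  have "perp L X X" "perp L Y Y" "perp L Y X"
    using assms perp_sym by (auto simp: singular_subspace_def)
  then show "perp L (X \<union> Y) (X \<union> Y)" using assms(3) by (auto simp: perp_def)
qed

lemma join_insert_span: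
  assumes "sing X" "sing Y" "p \<in> P"
  shows "join X (pspan (insert p Y)) = pspan (insert p (join X Y))"
proof -
  have P: "X \<subseteq> P" "Y \<subseteq> P" using assms sing_subset by auto
  have "join X (pspan (insert p Y)) = pspan (X \<union> insert p Y)"
    unfolding join_def using P assms(3) by (intro span_Un_span) auto
  also have "\<dots> = pspan (insert p (X \<union> Y))" by simp
  also have "\<dots> = pspan (insert p (join X Y))"
    unfolding join_def using P assms(3) by (intro span_insert_span[symmetric]) auto
  finally show ?thesis .
qed

text \<open>By induction on \<open>rk Y\<close>, a point \<open>w\<close> outside \<open>Y\<close>
  lies in the span of \<open>Y\<close> and a single \<open>x \<in> X\<close>, where
  \<open>cone_lines\<close> applies. The clause \<open>x \<notin> Y\<close> is what lets
  \<open>rk_modular\<close> reach a contradiction.\<close>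

lemma mem_join:
  assumes "sing X" "sing Y" "perp L X Y" "w \<in> join X Y"
  shows "w \<in> X \<or> w \<in> Y \<or> (\<exists>x\<in>X. \<exists>y\<in>Y. \<exists>l\<in>L. x \<notin> Y \<and> x \<in> l \<and> y \<in> l \<and> w \<in> l)"
  using assms(2-)
proof (induction "rk Y" arbitrary: Y w rule: less_induct)
  case less
  show ?case
  proof (cases "Y = {}")
    case True
    then show ?thesis using less.prems join_least[OF assms(1), of X "{}"] by auto
  next
    case False
    then obtain H p where H: "sing H" "H \<subseteq> Y" "p \<in> Y" "p \<notin> H" "Y = pspan (insert p H)" "rk Y = Suc (rk H)"
      using hyperplane_between[OF less.prems(1) sing_empty] by (metis empty_subsetI psubsetI)
    have pH: "perp L X H" using less.prems(2) H(2) perp_mono by blast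
    have J: "sing (join X H)" by (rule sing_join[OF assms(1) H(1) pH])
    have YP: "Y \<subseteq> P" and XP: "X \<subseteq> P" using less.prems assms(1) sing_subset by auto
    have joinY: "join X Y = pspan (insert p (join X H))"
      using join_insert_span[OF assms(1) H(1), of p] H YP by auto
    have IH: "v \<in> X \<or> v \<in> H \<or> (\<exists>x\<in>X. \<exists>y\<in>H. \<exists>l\<in>L. x \<notin> H \<and> x \<in> l \<and> y \<in> l \<and> v \<in> l)"
      if "v \<in> join X H" for v
      using less.hyps[OF _ H(1) pH that] H by simp
    have cone: ?thesis if x: "x \<in> X" "w \<in> pspan (insert x Y)" for x
    proof (cases "x \<in> Y")
      case True
      then have "pspan (insert x Y) = Y"
        using geom_span_eq[OF sing_subspace[OF less.prems(1)]] by (simp add: insert_absorb)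
      then show ?thesis using x by blast
    next
      case False
      have "\<forall>y\<in>Y. pt_collinear L x y" using less.prems(2) x(1) by (simp add: perp_def)
      then show ?thesis using cone_lines[OF less.prems(1) _ False _ x(2)] x(1) XP False by blast
    qed
    have Jsp: "\<exists>x\<in>X. v \<in> pspan (insert x Y)" if v: "v \<in> join X H" "v \<notin> Y" for v
    proof -
      consider "v \<in> X" | x y l where "x \<in> X" "y \<in> H" "l \<in> L" "x \<notin> H" "x \<in> l" "y \<in> l" "v \<in> l"
        using IH[OF v(1)] v(2) H(2) by blast
      then show ?thesis
      proof cases
        case 1
        then show ?thesis using geom_span_superset[of "insert v Y" P L] by blast
      next
        case 2
        have "geom_subspace P L (pspan (insert x Y))"
          using geom_subspace_span[of "insert x Y"] XP YP 2(1) by blast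
        moreover have "x \<in> pspan (insert x Y)" "y \<in> pspan (insert x Y)"
          using geom_span_superset[of "insert x Y" P L] 2 H by blast+
        ultimately have "v \<in> pspan (insert x Y)"
          using subspace_lineD[of _ l x y v] 2 by metis
        then show ?thesis using 2 by blast
      qed
    qed
    have sub: "X \<subseteq> P" "Y \<subseteq> P" by fact+
    show ?thesis
    proof (cases "w \<in> Y \<or> w \<in> join X H")
      case True
      then show ?thesis using Jsp cone by blast
    next
      case False
      have "p \<notin> join X H"
      proof
        assume "p \<in> join X H"
        then have "join X Y = join X H"
          using joinY geom_span_eq[OF sing_subspace[OF J]] by (simp add: insert_absorb)
        then show False using False less.prems(3) by blast
      qed
      moreover have "\<forall>x\<in>join X H. pt_collinear L p x"
      proof -
        have "sing (join X Y)" by (rule sing_join[OF assms(1) less.prems(1,2)])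
        then show ?thesis
          using sing_collinear join_upper(2)[of Y X] H(3) joinY geom_span_superset[of "insert p (join X H)" P L]
          by blast
      qed
      moreover have "w \<in> pspan (insert p (join X H))" using less.prems(3) joinY by simp
      \<comment> \<open>As \<open>p \<in> Y\<close>, a span of \<open>Y\<close> and some
        \<open>x\<close> that contains \<open>v\<close> also contains \<open>w\<close>.\<close>
      ultimately obtain v l where v: "v \<in> join X H" "l \<in> L" "p \<in> l" "w \<in> l" "v \<in> l"
        using cone_lines[OF J, of p w] False H(3) sub by blast
      have "v \<noteq> p" using v \<open>p \<notin> join X H\<close> by blast
      have "v \<notin> Y"
        using subspace_lineD[OF sing_subspace[OF less.prems(1)] v(2) _ H(3) \<open>v \<noteq> p\<close> v(5,3,4)] False by blast
      then obtain x where x: "x \<in> X" "v \<in> pspan (insert x Y)" using Jsp v by blast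
      have "geom_subspace P L (pspan (insert x Y))"
        using geom_subspace_span[of "insert x Y"] sub x(1) by blast
      moreover have "p \<in> pspan (insert x Y)"
        using geom_span_superset[of "insert x Y" P L] H by blast
      ultimately have "w \<in> pspan (insert x Y)"
        using subspace_lineD[of _ l v p w] v x \<open>v \<noteq> p\<close> by metis
      then show ?thesis using cone x by blast
    qed
  qed
qed

text \<open>Induction on \<open>rk Y\<close>: for a hyperplane \<open>H\<close> of \<open>Y\<close>
  above \<open>X \<inter> Y\<close>, passing from \<open>H\<close> to \<open>Y\<close> keeps the
  intersection with \<open>X\<close> and raises the rank of the join by one.\<close>

lemma rk_modular:
  assumes "sing X" "sing Y" "perp L X Y"
  shows "rk (join X Y) + rk (X \<inter> Y) = rk X + rk Y"
  using assms(2-)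
proof (induction "rk Y" arbitrary: Y rule: less_induct)
  case less
  show ?case
  proof (cases "Y \<subseteq> X")
    case True
    then have "join X Y = X" using join_least[OF assms(1), of X Y] join_upper(1)[of X Y] by blast
    then show ?thesis using True by (simp add: Int_absorb1)
  next
    case False
    have "X \<inter> Y \<subset> Y" using False by blast
    then obtain H p where H: "sing H" "X \<inter> Y \<subseteq> H" "H \<subseteq> Y" "p \<in> Y" "p \<notin> H" "Y = pspan (insert p H)" "rk Y = Suc (rk H)"
      using hyperplane_between[OF less.prems(1) sing_Int[OF assms(1) less.prems(1)]] by metis
    have XH: "X \<inter> H = X \<inter> Y" using H by blast
    have pH: "perp L X H" using less.prems(2) H(3) perp_mono by blast
    have J: "sing (join X H)" by (rule sing_join[OF assms(1) H(1) pH])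
    have YP: "Y \<subseteq> P" using less.prems sing_subset by auto
    have IH: "rk (join X H) + rk (X \<inter> Y) = rk X + rk H"
      using less.hyps[OF _ H(1) pH] H XH by simp
    have joinY: "join X Y = pspan (insert p (join X H))"
      using join_insert_span[OF assms(1) H(1), of p] H YP by auto
    \<comment> \<open>If \<open>p\<close> were on a line joining \<open>x \<in> X\<close> to
      \<open>y \<in> H\<close>, then \<open>x\<close> would lie in
      \<open>X \<inter> Y \<subseteq> H\<close>.\<close>
    have "p \<notin> join X H"
    proof
      assume "p \<in> join X H"
      then consider "p \<in> X" | x y l where "x \<in> X" "y \<in> H" "l \<in> L" "x \<notin> H" "x \<in> l" "y \<in> l" "p \<in> l"
        using mem_join[OF assms(1) H(1) pH] H by blast
      then show False
      proof cases
        case 2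
        then have "x \<in> Y"
          using subspace_lineD[OF sing_subspace[OF less.prems(1)], of l y p x] H by blast
        then show False using 2 H by blast
      qed (use H in blast)
    qed
    moreover have S: "sing (join X Y)" by (rule sing_join[OF assms(1) less.prems])
    moreover have "join X H \<subseteq> join X Y" "p \<in> join X Y"
      using joinY geom_span_superset[of "insert p (join X H)" P L] by blast+
    ultimately have "rk (join X Y) = Suc (rk (join X H))"
      using rk_span_insert_sub(2)[OF S J] joinY by simp
    then show ?thesis using IH H by simp
  qed
qed

lemma modular_in:
  assumes "sing Z" "sing X" "sing Y" "X \<subseteq> Z" "Y \<subseteq> Z"
  shows "sing (join X Y)" "join X Y \<subseteq> Z" "rk (join X Y) + rk (X \<inter> Y) = rk X + rk Y"
  using assms sing_perp[OF assms(1,4,5)] sing_join rk_modular join_least by auto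

section \<open>Maximal singular subspaces\<close>

lemma maximal_above:
  assumes "sing X" obtains M where "maximal_singular P L M" "X \<subseteq> M"
proof -
  let ?F = "{H. sing H \<and> X \<subseteq> H}"
  have "finite ?F" by (rule finite_sing)
  moreover have "?F \<noteq> {}" using assms by blast
  ultimately have "\<exists>H\<in>?F. \<forall>K\<in>?F. H \<subseteq> K \<longrightarrow> H = K" by (rule finite_has_maximal)
  then obtain M where "M \<in> ?F" "\<forall>K\<in>?F. M \<subseteq> K \<longrightarrow> M = K" by (rule bexE)
  then have "maximal_singular P L M" "X \<subseteq> M"
    unfolding maximal_singular_def by auto
  then show ?thesis by (rule that)
qed

lemma rk_maximal: "maximal_singular P L M \<Longrightarrow> rk M = n"
  using polar_rank proj_dim_eq[of M] by (simp add: has_polar_rank_def)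

lemma rk_le: "sing X \<Longrightarrow> rk X \<le> n"
  by (metis maximal_above maximal_singular_def rk_maximal rk_mono)

lemma maximal_iff: "maximal_singular P L M \<longleftrightarrow> sing M \<and> rk M = n"
proof
  assume "sing M \<and> rk M = n"
  then show "maximal_singular P L M"
    unfolding maximal_singular_def using rk_subset_eq[of M] rk_le by metis
qed (use rk_maximal in \<open>auto simp: maximal_singular_def\<close>)

lemma card_maximal_above:
  assumes "sing U" "Suc (rk U) = n"
  shows "card {M. sing M \<and> rk M = n \<and> U \<subseteq> M} = t + 1"
proof -
  have "proj_dim P L U = int n - 2" using assms proj_dim_eq[of U] by simp
  then have "card {M. maximal_singular P L M \<and> U \<subseteq> M} = t + 1"
    using polar_order assms(1) by (simp add: has_polar_order_def)
  then show ?thesis by (simp add: maximal_iff conj_assoc)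
qed

subsection \<open>Counting subspaces\<close>

text \<open>These are the points of the quotient of \<open>T\<close> by \<open>X\<close>. Likewise
  \<open>hyperplanes_above Z T\<close> stands for the hyperplanes of the quotient of
  \<open>T\<close> by \<open>Z\<close>, and \<open>covers X\<close> for the points of the residue of
  \<open>X\<close>.\<close>

definition covers_in :: "'a set \<Rightarrow> 'a set \<Rightarrow> 'a set set" where
  "covers_in X T = {W. sing W \<and> X \<subseteq> W \<and> W \<subseteq> T \<and> rk W = Suc (rk X)}"

definition hyperplanes_above :: "'a set \<Rightarrow> 'a set \<Rightarrow> 'a set set" where
  "hyperplanes_above Z T = {H. sing H \<and> Z \<subseteq> H \<and> H \<subseteq> T \<and> Suc (rk H) = rk T}"

definition covers :: "'a set \<Rightarrow> 'a set set" where
  "covers X = {W. sing W \<and> X \<subseteq> W \<and> rk W = Suc (rk X)}"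

lemma finite_covers_in: "finite (covers_in X T)" and finite_hyperplanes_above: "finite (hyperplanes_above X T)" and finite_covers: "finite (covers X)"
  unfolding covers_in_def hyperplanes_above_def covers_def by (rule finite_sing)+

lemma qnum_Suc: "qnum s (Suc k) = qnum s k + s ^ k"
  using qnum_add[of s k 1] by simp

lemma card_sing_Diff:
  assumes "sing T" "sing X" "X \<subseteq> T"
  shows "card (T - X) = s ^ rk X * qnum s (rk T - rk X)"
proof -
  have "card (T - X) = qnum s (rk T) - qnum s (rk X)"
    using assms card_Diff_subset[OF finite_sing_pts[OF assms(2)] assms(3)] card_sing by simp
  then show ?thesis using qnum_add[of s "rk X" "rk T - rk X"] rk_mono[OF assms(2,1,3)] by simp
qed

text \<open>Each point of \<open>T - X\<close> generates a cover \<open>W\<close> together with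
  \<open>X\<close>, and \<open>W\<close> arises from exactly the \<open>s ^ rk X\<close> points of
  \<open>W - X\<close>.\<close>

lemma card_covers_in:
  assumes "sing T" "sing X" "X \<subseteq> T"
  shows "card (covers_in X T) = qnum s (rk T - rk X)"
proof -
  have "card (T - X) = s ^ rk X * card (covers_in X T)"
  proof (rule card_by_fibres[where g = "\<lambda>p. pspan (insert p X)"])
    show "pspan (insert p X) \<in> covers_in X T" if "p \<in> T - X" for p
      using rk_span_insert_sub[OF assms, of p] that by (auto simp: covers_in_def)
    fix W assume "W \<in> covers_in X T"
    then have W: "sing W" "X \<subseteq> W" "W \<subseteq> T" "rk W = Suc (rk X)" by (auto simp: covers_in_def)
    have "pspan (insert p X) = W" if "p \<in> W" "p \<notin> X" for p
      using rk_span_insert_sub[OF W(1) assms(2) W(2) that] W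
      by (intro rk_subset_eq) auto
    moreover have "p \<in> pspan (insert p X)" for p using geom_span_superset[of "insert p X" P L] by blast
    ultimately have "{p \<in> T - X. pspan (insert p X) = W} = W - X" using W(3) by blast
    then show "card {p \<in> T - X. pspan (insert p X) = W} = s ^ rk X"
      using card_sing_Diff[OF W(1) assms(2) W(2)] W by simp
  qed (use assms finite_sing_pts finite_covers_in in auto)
  then show ?thesis using card_sing_Diff[OF assms] s_pos by simp
qed

lemma Int_eq_common_hyperplane:
  assumes "sing A" "sing B" "sing H" "H \<subseteq> A" "H \<subseteq> B" "rk A = Suc (rk H)" "rk B = Suc (rk H)" "A \<noteq> B"
  shows "A \<inter> B = H"
proof -
  have "\<not> rk A \<le> rk (A \<inter> B)"
  proof
    assume "rk A \<le> rk (A \<inter> B)"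
    then have "A \<inter> B = A" using assms sing_Int by (intro rk_subset_eq) auto
    then have "A = B" using assms by (intro rk_subset_eq) auto
    then show False using assms(8) by blast
  qed
  then have "H = A \<inter> B" using assms sing_Int by (intro rk_subset_eq) auto
  then show ?thesis by simp
qed

text \<open>Fix one hyperplane \<open>H0\<close> above \<open>Z\<close>. By the modular law the
  others meet it in hyperplanes \<open>K\<close> of \<open>H0\<close>, and each \<open>K\<close>
  arises from the \<open>s\<close> covers of \<open>K\<close> in \<open>T\<close> other than
  \<open>H0\<close>. This is the recursion of \<open>qnum\<close>.\<close>

lemma card_hyperplanes_above:
  assumes "sing T" "sing Z" "Z \<subseteq> T"
  shows "card (hyperplanes_above Z T) = qnum s (rk T - rk Z)"
  using assms
proof (induction "rk T - rk Z" arbitrary: T)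
  case 0
  then have "hyperplanes_above Z T = {}"
    using rk_mono[OF 0(3)] by (fastforce simp: hyperplanes_above_def)
  then show ?case using 0 by simp
next
  case (Suc m)
  have "Z \<subset> T" using Suc.hyps(2) Suc.prems by auto
  then obtain H0 where H0: "sing H0" "Z \<subseteq> H0" "H0 \<subseteq> T" "rk T = Suc (rk H0)"
    using hyperplane_between[OF Suc.prems(1,2)] by metis
  have "H0 \<in> hyperplanes_above Z T" using H0 by (simp add: hyperplanes_above_def)
  have "card (hyperplanes_above Z T - {H0}) = s * card (hyperplanes_above Z H0)"
  proof (rule card_by_fibres[where g = "\<lambda>H. H \<inter> H0"])
    fix H assume "H \<in> hyperplanes_above Z T - {H0}"
    then have H: "sing H" "Z \<subseteq> H" "H \<subseteq> T" "rk H = rk H0" "H \<noteq> H0" using H0 by (auto simp: hyperplanes_above_def)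
    have "rk (join H H0) + rk (H \<inter> H0) = rk H + rk H0" "sing (join H H0)" "join H H0 \<subseteq> T"
      using modular_in[OF Suc.prems(1) H(1) H0(1) H(3) H0(3)] by auto
    moreover have "\<not> rk (join H H0) \<le> rk H0"
    proof
      assume *: "rk (join H H0) \<le> rk H0"
      have "H0 = join H H0"
        by (rule rk_subset_eq[OF H0(1) _ join_upper(2) *]) fact
      then have "H \<subseteq> H0" using join_upper(1)[of H H0] by simp
      then have "H = H0" using H H0 by (intro rk_subset_eq) auto
      then show False using H by blast
    qed
    moreover have "rk (join H H0) \<le> rk T" using calculation Suc.prems(1) by (intro rk_mono) auto
    ultimately have "Suc (rk (H \<inter> H0)) = rk H0" using H H0 by linarith
    then show "H \<inter> H0 \<in> hyperplanes_above Z H0" using H H0 sing_Int by (auto simp: hyperplanes_above_def)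
  next
    fix K assume "K \<in> hyperplanes_above Z H0"
    then have K: "sing K" "Z \<subseteq> K" "K \<subseteq> H0" "Suc (rk K) = rk H0" by (auto simp: hyperplanes_above_def)
    have KT: "K \<subseteq> T" using K H0 by blast
    have "{H \<in> hyperplanes_above Z T - {H0}. H \<inter> H0 = K} = covers_in K T - {H0}"
    proof (intro equalityI subsetI)
      fix H assume "H \<in> {H \<in> hyperplanes_above Z T - {H0}. H \<inter> H0 = K}"
      then show "H \<in> covers_in K T - {H0}" using K H0 by (auto simp: hyperplanes_above_def covers_in_def)
    next
      fix H assume "H \<in> covers_in K T - {H0}"
      then have H: "sing H" "K \<subseteq> H" "H \<subseteq> T" "rk H = Suc (rk K)" "H \<noteq> H0" by (auto simp: covers_in_def)
      have "H \<inter> H0 = K"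
        using Int_eq_common_hyperplane[OF H(1) H0(1) K(1) H(2) K(3) H(4) _ H(5)] K(4) by simp
      then show "H \<in> {H \<in> hyperplanes_above Z T - {H0}. H \<inter> H0 = K}" using H H0 K by (auto simp: hyperplanes_above_def)
    qed
    moreover have "H0 \<in> covers_in K T" using K H0 by (simp add: covers_in_def)
    moreover have "card (covers_in K T) = Suc s"
    proof -
      have "rk T - rk K = Suc (Suc 0)" using K(4) H0(4) by simp
      then show ?thesis using card_covers_in[OF Suc.prems(1) K(1) KT] by simp
    qed
    ultimately show "card {H \<in> hyperplanes_above Z T - {H0}. H \<inter> H0 = K} = s" using finite_covers_in by simp
  qed (use finite_hyperplanes_above in auto)
  moreover have "card (hyperplanes_above Z H0) = qnum s m"
  proof -
    have "m = rk H0 - rk Z" using Suc.hyps(2) H0(4) by linarith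
    then show ?thesis using Suc.hyps(1)[OF _ H0(1) Suc.prems(2) H0(2)] by simp
  qed
  moreover have "card (hyperplanes_above Z T) = Suc (card (hyperplanes_above Z T - {H0}))"
    by (rule card.remove[OF finite_hyperplanes_above]) fact
  ultimately show ?case using Suc.hyps(2)[symmetric] by simp
qed

text \<open>As \<open>M\<close> has the largest possible rank, \<open>p\<close> is not collinear
  with all of it; but every line of \<open>M\<close> has a point collinear with \<open>p\<close>. So
  \<open>M\<close> is a cone over \<open>H\<close>, and \<open>cone_card\<close> gives the
  rank.\<close>

lemma perp_hyperplane:
  assumes M: "sing M" "rk M = n" and p: "p \<in> P" "p \<notin> M"
  defines "H \<equiv> {x \<in> M. pt_collinear L p x}"
  shows "sing H" "Suc (rk H) = n"
proof -
  have "H = M \<inter> {z \<in> P. \<forall>a\<in>{p}. a \<in> P \<longrightarrow> pt_collinear L a z}"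
    using sing_subset[OF M(1)] p by (auto simp: H_def)
  then have "geom_subspace P L H"
    using subspace_Int[OF sing_subspace[OF M(1)] geom_subspace_perp[of "{p}"]] by simp
  moreover have HM: "H \<subseteq> M" by (auto simp: H_def)
  ultimately show H: "sing H" using sing_perp[OF M(1)] by (simp add: singular_subspace_def)
  have "H \<noteq> M"
  proof
    assume "H = M"
    then have all: "\<forall>x\<in>M. pt_collinear L p x" by (auto simp: H_def)
    show False
      using rk_le[OF sing_span_insert[OF M(1) p(1) all]] rk_span_insert[OF M(1) p all] M(2) by simp
  qed
  then obtain m where m: "m \<in> M" "m \<notin> H" using HM by blast
  have "card M = Suc (s * card H)"
  proof (rule cone_card[OF M(1) H HM m])
    fix q assume "q \<in> M" "q \<noteq> m"
    then obtain l where l: "l \<in> L" "m \<in> l" "q \<in> l" "l \<subseteq> M" using sing_lineE[OF M(1) m(1), of q] by blast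
    obtain x where "x \<in> l" "pt_collinear L p x" using line_meets_perp[OF p(1) l(1)] .
    then show "\<exists>x\<in>H. \<exists>l\<in>L. m \<in> l \<and> q \<in> l \<and> x \<in> l" using l by (auto simp: H_def)
  qed
  then have "qnum s n = qnum s (Suc (rk H))" using card_sing[OF M(1)] card_sing[OF H] M(2) by simp
  then show "Suc (rk H) = n" by (metis qnum_eq_iff s_pos)
qed

text \<open>The number of points of a polar space of rank \<open>m\<close> and order
  \<open>(s, ..., s, t)\<close>. For \<open>m = 0\<close> the truncated \<open>m - 1\<close> is
  harmless, since \<open>qnum s 0 = 0\<close>.\<close>

definition res_pts :: "nat \<Rightarrow> nat" where
  "res_pts m = qnum s m * (t * s ^ (m - 1) + 1)"

text \<open>
  Fix a maximal \<open>M\<close> above \<open>X\<close>.  A cover \<open>W\<close> of \<open>X\<close> outside \<open>M\<close> determines the hyperplane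
  \<open>H = W\<^sup>\<bottom> \<inter> M\<close> of \<open>M\<close> and the maximal subspace \<open>M' \<noteq> M\<close> spanned by \<open>W\<close> and \<open>H\<close>; conversely, the covers
  belonging to \<open>(H, M')\<close> are those in \<open>M'\<close> but not in \<open>H\<close>.
\<close>

lemma card_covers:
  assumes X: "sing X" shows "card (covers X) = res_pts (n - rk X)"
proof -
  define m where "m = n - rk X"
  obtain M where M: "sing M" "rk M = n" "X \<subseteq> M"
    using maximal_above[OF X] by (auto simp: maximal_iff)
  define A where "A = {W \<in> covers X. \<not> W \<subseteq> M}"
  define B where "B = (SIGMA H : hyperplanes_above X M. {M'. sing M' \<and> rk M' = n \<and> H \<subseteq> M'} - {M})"
  define h where "h W = {x \<in> M. \<forall>w\<in>W. pt_collinear L w x}" for W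
  have finB: "finite B" unfolding B_def using finite_hyperplanes_above finite_sing by auto
  have "card B = (\<Sum>H\<in>hyperplanes_above X M. card ({M'. sing M' \<and> rk M' = n \<and> H \<subseteq> M'} - {M}))"
    unfolding B_def using finite_hyperplanes_above finite_sing by (intro card_SigmaI) auto
  also have "\<dots> = (\<Sum>H\<in>hyperplanes_above X M. t)"
  proof (rule sum.cong)
    fix H assume H: "H \<in> hyperplanes_above X M"
    then have "card {M'. sing M' \<and> rk M' = n \<and> H \<subseteq> M'} = t + 1"
      using M by (intro card_maximal_above) (auto simp: hyperplanes_above_def)
    moreover have "M \<in> {M'. sing M' \<and> rk M' = n \<and> H \<subseteq> M'}" using H M by (auto simp: hyperplanes_above_def)
    ultimately show "card ({M'. sing M' \<and> rk M' = n \<and> H \<subseteq> M'} - {M}) = t"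
      using card_Diff_singleton by (metis add_diff_cancel_right')
  qed simp
  also have "\<dots> = qnum s m * t" using card_hyperplanes_above[OF M(1) X M(3)] M(2) by (simp add: m_def)
  finally have cardB: "card B = qnum s m * t" .
  have gB: "(h W, join W (h W)) \<in> B" if "W \<in> A" for W
  proof -
    have W: "sing W" "X \<subseteq> W" "rk W = Suc (rk X)" "\<not> W \<subseteq> M" using that by (auto simp: A_def covers_def)
    then obtain p where p: "p \<in> W" "p \<notin> M" by blast
    have pX: "p \<notin> X" and pP: "p \<in> P" using p M sing_subset[OF W(1)] by auto
    have Wsp: "W = pspan (insert p X)"
      using rk_span_insert_sub[OF W(1) X W(2) p(1) pX] W by (intro rk_subset_eq[symmetric]) auto
    \<comment> \<open>As \<open>X \<subseteq> M\<close>, a point of \<open>M\<close> is collinear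
      with all of \<open>W\<close> iff it is collinear with the single point
      \<open>p\<close>.\<close>
    have hW: "h W = {x \<in> M. pt_collinear L p x}"
    proof (intro equalityI subsetI)
      fix x assume x: "x \<in> {x \<in> M. pt_collinear L p x}"
      have "pt_collinear L x w" if "w \<in> W" for w
      proof (rule collinear_span)
        show "w \<in> pspan (insert p X)" using that Wsp by simp
        show "\<forall>a\<in>insert p X. pt_collinear L x a"
          using x sing_collinear[OF M(1)] M(3) pt_collinear_sym[of L p x] by auto
      qed (use x sing_subset[OF M(1)] sing_subset[OF X] pP in auto)
      then show "x \<in> h W" using x pt_collinear_sym[of L x] by (auto simp: h_def)
    qed (use p in \<open>auto simp: h_def\<close>)
    have H: "sing (h W)" "Suc (rk (h W)) = n"
      using perp_hyperplane[OF M(1,2) pP p(2)] by (simp_all add: hW)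
    have XH: "X \<subseteq> h W" using M(3) W(2) sing_collinear[OF W(1)] by (auto simp: h_def)
    have "perp L W (h W)" by (auto simp: h_def perp_def)
    then have J: "sing (join W (h W))" using sing_join W H by blast
    have pJ: "p \<in> join W (h W)" using join_upper(1) p by blast
    have pH: "p \<notin> h W" using p by (auto simp: h_def)
    have "rk (pspan (insert p (h W))) = n" "pspan (insert p (h W)) \<subseteq> join W (h W)" "sing (pspan (insert p (h W)))"
      using rk_span_insert_sub[OF J H(1) join_upper(2) pJ pH] H by auto
    then have "rk (join W (h W)) = n" using rk_le[OF J] rk_mono[OF _ J] by (metis le_antisym)
    moreover have "join W (h W) \<noteq> M" using join_upper(1) W(4) by blast
    ultimately show ?thesis
      using H XH M(2) J join_upper(2) by (auto simp: B_def hyperplanes_above_def h_def)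
  qed
  have "card A = s ^ (m - 1) * card B"
  proof (rule card_by_fibres[OF _ finB gB])
    show "finite A" using finite_covers by (simp add: A_def)
    fix b assume b: "b \<in> B"
    obtain H M' where HM: "b = (H, M')" by (cases b)
    then have H: "sing H" "X \<subseteq> H" "H \<subseteq> M" "Suc (rk H) = n" and M': "sing M'" "rk M' = n" "H \<subseteq> M'" "M' \<noteq> M"
      using b M by (auto simp: B_def hyperplanes_above_def)
    have "{W \<in> A. (h W, join W (h W)) = b} = covers_in X M' - covers_in X H"
    proof (intro equalityI subsetI)
      fix W assume W: "W \<in> {W \<in> A. (h W, join W (h W)) = b}"
      then have "W \<subseteq> M'" using HM join_upper(1)[of W "h W"] by auto
      then show "W \<in> covers_in X M' - covers_in X H" using W H by (auto simp: A_def covers_in_def covers_def)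
    next
      fix W assume "W \<in> covers_in X M' - covers_in X H"
      then have W: "sing W" "X \<subseteq> W" "W \<subseteq> M'" "rk W = Suc (rk X)" "\<not> W \<subseteq> H" by (auto simp: covers_in_def)
      \<comment> \<open>Hence \<open>W\<close>, which lies in \<open>M'\<close> but not in
        \<open>H\<close>, does not lie in \<open>M\<close>.\<close>
      have "M \<inter> M' = H"
        using Int_eq_common_hyperplane[OF M(1) M'(1) H(1) H(3) M'(3)] M M' H by auto
      then have WA: "W \<in> A" using W by (auto simp: A_def covers_def)
      note g = gB[OF WA]
      have "H \<subseteq> h W" using H(3) M'(3) W(3) sing_collinear[OF M'(1)] by (force simp: h_def)
      then have hH: "h W = H" using g H M by (intro rk_subset_eq[symmetric]) (auto simp: B_def hyperplanes_above_def)
      have "join W H = M'"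
      proof (rule rk_subset_eq)
        show "join W H \<subseteq> M'" by (rule join_least[OF M'(1) W(3) M'(3)])
      qed (use g hH M' in \<open>auto simp: B_def\<close>)
      then show "W \<in> {W \<in> A. (h W, join W (h W)) = b}" using WA hH HM by simp
    qed
    moreover have "card (covers_in X M' - covers_in X H) = card (covers_in X M') - card (covers_in X H)"
      using M'(3) by (intro card_Diff_subset finite_covers_in) (auto simp: covers_in_def)
    moreover have "card (covers_in X M') = qnum s m"
      using card_covers_in[OF M'(1) X] H M' by (auto simp: m_def)
    moreover have "card (covers_in X H) = qnum s (m - 1)"
      using card_covers_in[OF H(1) X H(2)] H(4) by (auto simp: m_def)
    \<comment> \<open>\<open>H\<close> is a hyperplane of \<open>M\<close> above \<open>X\<close>,
      so \<open>m\<close> is positive and \<open>m - 1\<close> is not truncated.\<close>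
    moreover have "m = Suc (m - 1)" using rk_mono[OF X H(1,2)] H(4) by (simp add: m_def)
    ultimately show "card {W \<in> A. (h W, join W (h W)) = b} = s ^ (m - 1)"
      using qnum_Suc[of "m - 1"] by simp
  qed
  moreover have "card (covers X) = card (covers_in X M) + card A"
  proof -
    have "covers X = covers_in X M \<union> A" by (auto simp: covers_def covers_in_def A_def)
    moreover have "covers_in X M \<inter> A = {}" by (auto simp: covers_in_def A_def)
    moreover have "finite A" using finite_covers by (simp add: A_def)
    ultimately show ?thesis using card_Un_disjoint[OF finite_covers_in] by simp
  qed
  moreover have "card (covers_in X M) = qnum s m" using card_covers_in[OF M(1) X M(3)] M(2) by (simp add: m_def)
  ultimately show ?thesis unfolding m_def[symmetric] res_pts_def by (simp add: cardB algebra_simps)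
qed

text \<open>In the quotient by \<open>X\<close>, these are the points off a hyperplane, that is, the
  points of an affine space.\<close>

lemma card_covers_in_Diff:
  assumes "sing T" "sing S" "sing X" "X \<subseteq> S" "S \<subseteq> T" "rk T = Suc (rk S)"
  shows "card (covers_in X T - covers_in X S) = s ^ (rk S - rk X)"
proof -
  have "card (covers_in X T - covers_in X S) = card (covers_in X T) - card (covers_in X S)"
    using assms(5) by (intro card_Diff_subset finite_covers_in) (auto simp: covers_in_def)
  also have "\<dots> = qnum s (Suc (rk S - rk X)) - qnum s (rk S - rk X)"
    using card_covers_in[OF assms(1,3)] card_covers_in[OF assms(2,3,4)] assms rk_mono[OF assms(3,2,4)]
    by (simp add: Suc_diff_le)
  finally show ?thesis using qnum_Suc by simp
qed

text \<open>Each such \<open>Y \<noteq> X\<close> spans with \<open>X\<close> a cover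
  \<open>W\<close> of \<open>X\<close>. As \<open>W\<close> has rank two over \<open>U\<close>, it
  contains \<open>s\<close> covers of \<open>U\<close> besides \<open>X\<close>. The extra one
  counts \<open>X\<close> itself.\<close>

lemma card_covers_perp:
  assumes X: "sing X" and U: "U \<in> hyperplanes_above {} X"
  shows "card {Y \<in> covers U. perp L X Y} = Suc (s * card (covers X))"
proof -
  have U: "sing U" "U \<subseteq> X" "rk X = Suc (rk U)" using U by (auto simp: hyperplanes_above_def)
  have "card ({Y \<in> covers U. perp L X Y} - {X}) = s * card (covers X)"
  proof (rule card_by_fibres[where g = "join X"])
    fix Y assume "Y \<in> {Y \<in> covers U. perp L X Y} - {X}"
    then have Y: "sing Y" "U \<subseteq> Y" "rk Y = Suc (rk U)" "perp L X Y" "X \<noteq> Y" by (auto simp: covers_def)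
    have "X \<inter> Y = U" by (rule Int_eq_common_hyperplane[OF X Y(1) U(1,2) Y(2) U(3) Y(3,5)])
    then have "rk (join X Y) = Suc (rk X)" using rk_modular[OF X Y(1,4)] Y U by simp
    then show "join X Y \<in> covers X" using sing_join[OF X Y(1,4)] join_upper(1) by (simp add: covers_def)
  next
    fix W assume "W \<in> covers X"
    then have W: "sing W" "X \<subseteq> W" "rk W = Suc (rk X)" by (auto simp: covers_def)
    have "{Y \<in> {Y \<in> covers U. perp L X Y} - {X}. join X Y = W} = covers_in U W - {X}"
    proof (intro equalityI subsetI)
      fix Y assume Y: "Y \<in> {Y \<in> {Y \<in> covers U. perp L X Y} - {X}. join X Y = W}"
      then have "Y \<subseteq> W" using join_upper(2)[of Y X] by blast
      then show "Y \<in> covers_in U W - {X}" using Y by (auto simp: covers_def covers_in_def)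
    next
      fix Y assume "Y \<in> covers_in U W - {X}"
      then have Y: "sing Y" "U \<subseteq> Y" "Y \<subseteq> W" "rk Y = Suc (rk U)" "X \<noteq> Y" by (auto simp: covers_in_def)
      have p: "perp L X Y" by (rule sing_perp[OF W(1,2) Y(3)])
      have "X \<inter> Y = U" by (rule Int_eq_common_hyperplane[OF X Y(1) U(1,2) Y(2) U(3) Y(4,5)])
      then have "rk (join X Y) = rk W" using rk_modular[OF X Y(1) p] Y U W by simp
      then have "join X Y = W"
        using sing_join[OF X Y(1) p] join_least[OF W(1,2) Y(3)] W(1) by (intro rk_subset_eq) auto
      then show "Y \<in> {Y \<in> {Y \<in> covers U. perp L X Y} - {X}. join X Y = W}"
        using Y p by (auto simp: covers_def)
    qed
    moreover have "X \<in> covers_in U W" using X U W by (simp add: covers_in_def)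
    moreover have "card (covers_in U W) = Suc s"
    proof -
      have "rk W - rk U = Suc (Suc 0)" "U \<subseteq> W" using W U by auto
      then show ?thesis using card_covers_in[OF W(1) U(1)] by simp
    qed
    ultimately show "card {Y \<in> {Y \<in> covers U. perp L X Y} - {X}. join X Y = W} = s"
      using finite_covers_in by simp
  qed (use finite_covers in auto)
  moreover have "X \<in> {Y \<in> covers U. perp L X Y}" using X U sing_perp[OF X] by (simp add: covers_def)
  ultimately show ?thesis using card.remove[of "{Y \<in> covers U. perp L X Y}" X] finite_covers by simp
qed

text \<open>In a polar space of rank \<open>c + 1\<close>, the two summands count the points
  collinear and not collinear with a given point. The case split handles the \<open>c - 1\<close> in
  \<open>res_pts\<close>.\<close>

lemma res_pts_Suc: "res_pts (Suc c) = Suc (s * res_pts c) + t * s ^ (2 * c)"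
proof (cases c)
  case (Suc d)
  have "res_pts (Suc c) = qnum s (Suc c) + t * s ^ c * (qnum s c + s ^ c)"
    by (simp only: qnum_Suc[symmetric]) (simp add: res_pts_def algebra_simps)
  also have "\<dots> = Suc (s * res_pts c) + t * s ^ (2 * c)"
    by (simp add: res_pts_def Suc algebra_simps power_add mult_2_right)
  finally show ?thesis .
qed (simp add: res_pts_def)

text \<open>Let \<open>c = n - rk X\<close>. For each hyperplane \<open>U\<close> of
  \<open>X\<close>, \<open>card_covers_perp\<close> leaves \<open>t * s ^ (2 * c)\<close> of the
  \<open>res_pts (c + 1)\<close> covers of \<open>U\<close>, by \<open>res_pts_Suc\<close>.\<close>

lemma card_near_nonperp:
  assumes X: "sing X"
  shows "card {Y. sing Y \<and> rk Y = rk X \<and> Suc (rk (X \<inter> Y)) = rk X \<and> \<not> perp L X Y}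
    = qnum s (rk X) * (t * s ^ (2 * (n - rk X)))"
proof -
  let ?A = "{Y. sing Y \<and> rk Y = rk X \<and> Suc (rk (X \<inter> Y)) = rk X \<and> \<not> perp L X Y}"
  have "card ?A = t * s ^ (2 * (n - rk X)) * card (hyperplanes_above {} X)"
  proof (rule card_by_fibres[where g = "\<lambda>Y. X \<inter> Y"])
    show "finite ?A" by (rule finite_sing)
    show "X \<inter> Y \<in> hyperplanes_above {} X" if "Y \<in> ?A" for Y using that X sing_Int by (auto simp: hyperplanes_above_def)
    fix U assume Uh: "U \<in> hyperplanes_above {} X"
    then have U: "sing U" "U \<subseteq> X" "rk X = Suc (rk U)" by (auto simp: hyperplanes_above_def)
    have "{Y \<in> ?A. X \<inter> Y = U} = covers U - {Y \<in> covers U. perp L X Y}"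
    proof (intro equalityI subsetI)
      fix Y assume "Y \<in> {Y \<in> ?A. X \<inter> Y = U}"
      then show "Y \<in> covers U - {Y \<in> covers U. perp L X Y}" using U by (auto simp: covers_def)
    next
      fix Y assume "Y \<in> covers U - {Y \<in> covers U. perp L X Y}"
      then have Y: "sing Y" "U \<subseteq> Y" "rk Y = Suc (rk U)" "\<not> perp L X Y" by (auto simp: covers_def)
      have "X \<noteq> Y" using Y(4) sing_perp[OF X] by blast
      then have "X \<inter> Y = U" using Int_eq_common_hyperplane[OF X Y(1) U(1,2) Y(2) U(3) Y(3)] by blast
      then show "Y \<in> {Y \<in> ?A. X \<inter> Y = U}" using Y U by simp
    qed
    moreover have "card (covers U - {Y \<in> covers U. perp L X Y}) = card (covers U) - card {Y \<in> covers U. perp L X Y}"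
      using finite_covers by (intro card_Diff_subset) auto
    moreover have "card (covers U) = res_pts (Suc (n - rk X))"
      using card_covers[OF U(1)] U(3) rk_le[OF X] by (simp add: Suc_diff_Suc)
    moreover have "card {Y \<in> covers U. perp L X Y} = Suc (s * res_pts (n - rk X))"
      using card_covers_perp[OF X Uh] card_covers[OF X] by simp
    ultimately show "card {Y \<in> ?A. X \<inter> Y = U} = t * s ^ (2 * (n - rk X))"
      using res_pts_Suc[of "n - rk X"] by simp
  qed (rule finite_hyperplanes_above)
  then show ?thesis using card_hyperplanes_above[OF X sing_empty] by simp
qed

section \<open>The numbers \<open>N r\<close>, as cardinalities of \<open>perp_at X r\<close>, and
  their recursion\<close>

definition perp_at :: "'a set \<Rightarrow> nat \<Rightarrow> 'a set set" where
  "perp_at X r = {Y. sing Y \<and> rk Y = rk X \<and> perp L X Y \<and> rk (X \<inter> Y) + r = rk X}"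

lemma finite_perp_at: "finite (perp_at X r)"
  unfolding perp_at_def by (rule finite_sing)

lemma rk_join_perp_at: "sing X \<Longrightarrow> Y \<in> perp_at X r \<Longrightarrow> rk (join X Y) = rk X + r"
  using rk_modular[of X Y] by (auto simp: perp_at_def)

text \<open>This serves hyperplanes \<open>H\<close> of \<open>Y\<close> that do not contain
  \<open>X \<inter> Y\<close>. The bound on \<open>rk (X \<inter> H)\<close> makes the modular law
  give \<open>join X H\<close> rank at least \<open>rk X + r\<close>.\<close>

lemma join_hyperplane:
  assumes X: "sing X" and Y: "Y \<in> perp_at X r" and H: "sing H" "H \<subseteq> Y" "Suc (rk H) = rk X"
    and r: "rk (X \<inter> H) + r < rk X"
  shows "join X H = join X Y"
proof -
  have Y': "sing Y" "perp L X Y" using Y by (auto simp: perp_at_def)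
  have p: "perp L X H" using Y'(2) H(2) perp_mono by blast
  have J: "sing (join X Y)" by (rule sing_join[OF X Y'])
  show ?thesis
  proof (rule rk_subset_eq[OF sing_join[OF X H(1) p] J])
    show "join X H \<subseteq> join X Y"
      using join_upper[of X Y] join_upper(2)[of Y X] H(2) by (intro join_least[OF J]) auto
    show "rk (join X Y) \<le> rk (join X H)"
      using rk_join_perp_at[OF X Y] rk_modular[OF X H(1) p] H(3) r by linarith
  qed
qed

text \<open>Map \<open>Y'\<close> to the pair of \<open>Y \<inter> Y'\<close>, a hyperplane of
  \<open>Y\<close> not containing \<open>X \<inter> Y\<close>, and \<open>join X Y'\<close>, a cover
  of \<open>W = join X Y\<close>. With \<open>a = rk X\<close> there are
  \<open>[a] - [r] = s ^ r * [a - r]\<close> such hyperplanes, and each pair arises from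
  \<open>s ^ (r + 1)\<close> subspaces.\<close>

lemma card_perp_at_up:
  assumes X: "sing X" and Y: "Y \<in> perp_at X r"
  shows "card {Y' \<in> perp_at X (Suc r). Suc (rk (Y \<inter> Y')) = rk X}
    = s ^ (2 * r + 1) * qnum s (rk X - r) * res_pts (n - rk X - r)"
proof -
  define W where "W = join X Y"
  have Y': "sing Y" "rk Y = rk X" "perp L X Y" "rk (X \<inter> Y) + r = rk X" using Y by (auto simp: perp_at_def)
  have W: "sing W" "X \<subseteq> W" "Y \<subseteq> W" "rk W = rk X + r"
    using sing_join[OF X Y'(1,3)] join_upper rk_join_perp_at[OF X Y] by (auto simp: W_def)
  have XY: "sing (X \<inter> Y)" by (rule sing_Int[OF X Y'(1)])
  define Hs where "Hs = hyperplanes_above {} Y - hyperplanes_above (X \<inter> Y) Y"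
  have "card Hs = card (hyperplanes_above {} Y) - card (hyperplanes_above (X \<inter> Y) Y)"
    unfolding Hs_def by (intro card_Diff_subset finite_hyperplanes_above) (auto simp: hyperplanes_above_def)
  also have "\<dots> = qnum s (rk X) - qnum s r"
  proof -
    have "rk Y - rk (X \<inter> Y) = r" using Y'(2,4) by linarith
    then show ?thesis using card_hyperplanes_above[OF Y'(1) sing_empty] card_hyperplanes_above[OF Y'(1) XY] Y'(2) by simp
  qed
  also have "\<dots> = s ^ r * qnum s (rk X - r)"
    using qnum_add[of s r "rk X - r"] Y'(4) by simp
  finally have cardHs: "card Hs = s ^ r * qnum s (rk X - r)" .
  have Hs: "sing H" "H \<subseteq> Y" "Suc (rk H) = rk X" "join X H = W" if "H \<in> Hs" for H
  proof -
    show H: "sing H" "H \<subseteq> Y" "Suc (rk H) = rk X" using that Y' by (auto simp: Hs_def hyperplanes_above_def)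
    have "\<not> X \<inter> Y \<subseteq> H" using that by (auto simp: Hs_def hyperplanes_above_def)
    have "\<not> rk (X \<inter> Y) \<le> rk (X \<inter> H)"
    proof
      assume "rk (X \<inter> Y) \<le> rk (X \<inter> H)"
      then have "X \<inter> H = X \<inter> Y" using H(2) by (intro rk_subset_eq sing_Int X H(1) Y'(1)) auto
      then show False using \<open>\<not> X \<inter> Y \<subseteq> H\<close> by blast
    qed
    then show "join X H = W" unfolding W_def using Y'(4) by (intro join_hyperplane[OF X Y H]) linarith
  qed
  let ?A = "{Y' \<in> perp_at X (Suc r). Suc (rk (Y \<inter> Y')) = rk X}"
  have "card ?A = s ^ (r + 1) * card (Hs \<times> covers W)"
  proof (rule card_by_fibres[where g = "\<lambda>V. (Y \<inter> V, join X V)"])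
    show "finite ?A" "finite (Hs \<times> covers W)" using finite_perp_at finite_hyperplanes_above finite_covers by (auto simp: Hs_def)
    fix V assume "V \<in> ?A"
    then have nV: "V \<in> perp_at X (Suc r)" and VY: "Suc (rk (Y \<inter> V)) = rk X"
      and V: "sing V" "rk V = rk X" "perp L X V" "rk (X \<inter> V) + Suc r = rk X" by (auto simp: perp_at_def)
    have H: "sing (Y \<inter> V)" by (rule sing_Int[OF Y'(1) V(1)])
    have rX: "rk (X \<inter> (Y \<inter> V)) \<le> rk (X \<inter> V)"
      by (intro rk_mono sing_Int X V(1) Y'(1)) auto
    have "\<not> X \<inter> Y \<subseteq> Y \<inter> V"
    proof
      assume "X \<inter> Y \<subseteq> Y \<inter> V"
      then have "rk (X \<inter> Y) \<le> rk (X \<inter> V)" by (intro rk_mono sing_Int X V(1) Y'(1)) auto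
      then show False using Y' V by linarith
    qed
    then have "Y \<inter> V \<in> Hs" using H VY Y' by (auto simp: Hs_def hyperplanes_above_def)
    moreover have "join X V \<in> covers W"
    proof -
      have J: "sing (join X V)" by (rule sing_join[OF X V(1,3)])
      have "join X (Y \<inter> V) \<subseteq> join X V"
        using join_upper[of X V] join_upper(2)[of V X] by (intro join_least[OF J]) auto
      then have "W \<subseteq> join X V" using Hs(4)[OF \<open>Y \<inter> V \<in> Hs\<close>] by simp
      then show ?thesis using J rk_join_perp_at[OF X nV] W(4) by (simp add: covers_def)
    qed
    ultimately show "(Y \<inter> V, join X V) \<in> Hs \<times> covers W" by simp
  next
    fix b assume "b \<in> Hs \<times> covers W"
    then obtain H V where b: "b = (H, V)" "H \<in> Hs" "V \<in> covers W" by blast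
    note H = Hs[OF b(2)]
    have V: "sing V" "W \<subseteq> V" "rk V = Suc (rk W)" using b(3) by (auto simp: covers_def)
    \<comment> \<open>A cover of \<open>H\<close> in \<open>V\<close> that is not contained in
      \<open>W\<close> differs from \<open>Y\<close>, so it meets \<open>Y\<close> in
      \<open>H\<close>; and its join with \<open>X\<close> contains \<open>W = join X H\<close>
      properly, so it is \<open>V\<close>.\<close>
    have "{Z \<in> ?A. (Y \<inter> Z, join X Z) = b} = covers_in H V - covers_in H W"
    proof (intro equalityI subsetI)
      fix Z assume "Z \<in> {Z \<in> ?A. (Y \<inter> Z, join X Z) = b}"
      then have Z: "sing Z" "rk Z = rk X" "Y \<inter> Z = H" "join X Z = V" using b by (auto simp: perp_at_def)
      have "Z \<subseteq> V" using Z(4) join_upper(2)[of Z X] by simp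
      moreover have "\<not> Z \<subseteq> W"
      proof
        assume "Z \<subseteq> W"
        then have "V \<subseteq> W" using join_least[OF W(1,2)] Z(4) by blast
        then show False using rk_mono[OF V(1) W(1)] V(3) by simp
      qed
      ultimately show "Z \<in> covers_in H V - covers_in H W" using Z H by (auto simp: covers_in_def)
    next
      fix Z assume "Z \<in> covers_in H V - covers_in H W"
      then have Z: "sing Z" "H \<subseteq> Z" "Z \<subseteq> V" "rk Z = rk X" "\<not> Z \<subseteq> W" using H by (auto simp: covers_in_def)
      have XV: "X \<subseteq> V" using W V by blast
      have p: "perp L X Z" by (rule sing_perp[OF V(1) XV Z(3)])
      have J: "sing (join X Z)" by (rule sing_join[OF X Z(1) p])
      have "Y \<noteq> Z" using Z(5) W(3) by blast
      then have YZ: "Y \<inter> Z = H"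
        using Int_eq_common_hyperplane[OF Y'(1) Z(1) H(1,2) Z(2)] H(3) Y'(2) Z(4) by simp
      have "W \<subseteq> join X Z"
        using join_least[OF J join_upper(1), of H] join_upper(2)[of Z X] Z(2) H(4) by blast
      moreover have "\<not> rk (join X Z) \<le> rk W"
      proof
        assume "rk (join X Z) \<le> rk W"
        then have "W = join X Z" using calculation W(1) J by (intro rk_subset_eq) auto
        then show False using Z(5) join_upper(2)[of Z X] by simp
      qed
      ultimately have JV: "join X Z = V"
        using V(3) by (intro rk_subset_eq[OF J V(1) join_least[OF V(1) XV Z(3)]]) simp
      have "rk (X \<inter> Z) + Suc r = rk X"
        using rk_modular[OF X Z(1) p] JV V(3) W(4) Z(4) by simp
      then show "Z \<in> {Z \<in> ?A. (Y \<inter> Z, join X Z) = b}"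
        using Z p YZ JV b(1) H(3) by (simp add: perp_at_def)
    qed
    moreover have "card (covers_in H V - covers_in H W) = s ^ (r + 1)"
    proof -
      have "rk W - rk H = r + 1" using W(4) H(3) by simp
      then show ?thesis using card_covers_in_Diff[OF V(1) W(1) H(1) _ V(2,3)] H(2) W(3) by simp
    qed
    ultimately show "card {Z \<in> ?A. (Y \<inter> Z, join X Z) = b} = s ^ (r + 1)" by simp
  qed
  also have "card (Hs \<times> covers W) = s ^ r * qnum s (rk X - r) * res_pts (n - rk X - r)"
    using cardHs card_covers[OF W(1)] W(4) by (simp add: card_cartesian_product)
  finally show ?thesis by (simp add: mult_2_right power_add algebra_simps)
qed

text \<open>\<open>Y\<close> is the join of \<open>Y \<inter> V\<close>, a hyperplane of
  \<open>V\<close>, and \<open>X \<inter> Y\<close>. Both lie above \<open>Z = X \<inter> V\<close>,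
  and they can be chosen independently in \<open>[r + 1]\<close> ways each.\<close>

lemma card_perp_at_down:
  assumes X: "sing X" and V: "V \<in> perp_at X (Suc r)"
  shows "card {Y \<in> perp_at X r. Suc (rk (Y \<inter> V)) = rk X} = (qnum s (Suc r))\<^sup>2"
proof -
  define Z where "Z = X \<inter> V"
  have V': "sing V" "rk V = rk X" "perp L X V" "rk Z + Suc r = rk X" using V by (auto simp: perp_at_def Z_def)
  have Z: "sing Z" "Z \<subseteq> X" "Z \<subseteq> V" unfolding Z_def using sing_Int[OF X V'(1)] by auto
  let ?A = "{Y \<in> perp_at X r. Suc (rk (Y \<inter> V)) = rk X}"
  have "card ?A = 1 * card (hyperplanes_above Z V \<times> covers_in Z X)"
  proof (rule card_by_fibres[where g = "\<lambda>Y. (Y \<inter> V, X \<inter> Y)"])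
    show "finite ?A" "finite (hyperplanes_above Z V \<times> covers_in Z X)" using finite_perp_at finite_hyperplanes_above finite_covers_in by auto
    fix Y assume "Y \<in> ?A"
    then have Y: "sing Y" "rk Y = rk X" "rk (X \<inter> Y) + r = rk X" "Suc (rk (Y \<inter> V)) = rk X"
      by (auto simp: perp_at_def)
    have S: "sing (Y \<inter> V)" "sing (X \<inter> Y)" using sing_Int X Y(1) V'(1) by auto
    note J = modular_in[OF Y(1) S(2,1)]
    \<comment> \<open>By the modular law in \<open>Y\<close>, with \<open>a = rk X\<close>, the two
      subspaces meet in rank at least \<open>(a - r) + (a - 1) - a = rk Z\<close>.\<close>
    have "rk (join (X \<inter> Y) (Y \<inter> V)) \<le> rk Y" using J by (intro rk_mono) (use Y(1) in auto)
    then have "rk Z \<le> rk ((X \<inter> Y) \<inter> (Y \<inter> V))" using J(3) Y V' by auto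
    moreover have "(X \<inter> Y) \<inter> (Y \<inter> V) \<subseteq> Z" by (auto simp: Z_def)
    ultimately have "(X \<inter> Y) \<inter> (Y \<inter> V) = Z" using sing_Int[OF S(2,1)] Z(1) by (intro rk_subset_eq)
    then have "Z \<subseteq> Y \<inter> V" "Z \<subseteq> X \<inter> Y" by auto
    then show "(Y \<inter> V, X \<inter> Y) \<in> hyperplanes_above Z V \<times> covers_in Z X"
      using S Y V' by (auto simp: hyperplanes_above_def covers_in_def)
  next
    fix b assume "b \<in> hyperplanes_above Z V \<times> covers_in Z X"
    then obtain H Q where b: "b = (H, Q)"
      and H: "sing H" "Z \<subseteq> H" "H \<subseteq> V" "Suc (rk H) = rk X"
      and Q: "sing Q" "Z \<subseteq> Q" "Q \<subseteq> X" "rk Q = Suc (rk Z)"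
      using V' by (auto simp: hyperplanes_above_def covers_in_def)
    define T where "T = join X V"
    have T: "sing T" "X \<subseteq> T" "V \<subseteq> T"
      using sing_join[OF X V'(1,3)] join_upper by (auto simp: T_def)
    define Y where "Y = join H Q"
    have "H \<inter> Q = Z" using H Q by (auto simp: Z_def)
    then have Y: "sing Y" "Y \<subseteq> T" "rk Y = rk X"
      using modular_in[OF T(1) H(1) Q(1)] H Q T V'(4) by (auto simp: Y_def)
    have HY: "H \<subseteq> Y" and QY: "Q \<subseteq> Y" using join_upper by (auto simp: Y_def)
    have p: "perp L X Y" by (rule sing_perp[OF T(1,2) Y(2)])
    have "\<not> Q \<subseteq> Z" using rk_mono[OF Q(1) Z(1)] Q(4) by auto
    then have "Y \<noteq> V" using QY Q by (auto simp: Z_def)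
    then have YV: "Y \<inter> V = H"
      using Int_eq_common_hyperplane[OF Y(1) V'(1) H(1) HY H(3)] Y V' H by simp
    have XY: "sing (X \<inter> Y)" by (rule sing_Int[OF X Y(1)])
    \<comment> \<open>\<open>X \<inter> Y\<close> meets the hyperplane \<open>H\<close> of
      \<open>Y\<close> in rank at most \<open>rk Z\<close>, so its own rank is at most
      \<open>rk Z + 1 = rk Q\<close>.\<close>
    have "Q = X \<inter> Y"
    proof (rule rk_subset_eq[OF Q(1) XY])
      have J: "sing (join (X \<inter> Y) H)" "join (X \<inter> Y) H \<subseteq> Y"
        "rk (join (X \<inter> Y) H) + rk (X \<inter> Y \<inter> H) = rk (X \<inter> Y) + rk H"
        using modular_in[OF Y(1) XY H(1) _ HY] by auto
      have "rk (join (X \<inter> Y) H) \<le> rk Y" by (rule rk_mono[OF J(1) Y(1) J(2)])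
      moreover have "rk (X \<inter> Y \<inter> H) \<le> rk Z"
        using H by (intro rk_mono sing_Int[OF XY H(1)] Z(1)) (auto simp: Z_def)
      ultimately show "rk (X \<inter> Y) \<le> rk Q" using J(3) Y H Q by linarith
    qed (use Q QY in auto)
    then have "Y \<in> ?A" using Y p YV H Q V' by (auto simp: perp_at_def)
    moreover have "Y' = Y" if Y': "Y' \<in> ?A" "(Y' \<inter> V, X \<inter> Y') = b" for Y'
    proof -
      have "H \<subseteq> Y'" "Q \<subseteq> Y'" "sing Y'" "rk Y' = rk X" using Y' b by (auto simp: perp_at_def)
      then show ?thesis
        unfolding Y_def[symmetric] using join_least[of Y' H Q] Y
        by (intro rk_subset_eq[symmetric]) (auto simp: Y_def)
    qed
    ultimately have "{Y' \<in> ?A. (Y' \<inter> V, X \<inter> Y') = b} = {Y}"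
      using YV \<open>Q = X \<inter> Y\<close> b by auto
    then show "card {Y' \<in> ?A. (Y' \<inter> V, X \<inter> Y') = b} = 1" by simp
  qed
  moreover have "rk V - rk Z = Suc r" "rk X - rk Z = Suc r" using V' by auto
  ultimately show ?thesis
    using card_hyperplanes_above[OF V'(1) Z(1,3)] card_covers_in[OF X Z(1,2)]
    by (simp add: card_cartesian_product power2_eq_square)
qed

text \<open>The pairs are counted from \<open>Y\<close> by \<open>card_perp_at_up\<close> and from
  \<open>V\<close> by \<open>card_perp_at_down\<close>. At \<open>r = n - rk X\<close> the factor
  \<open>res_pts 0 = 0\<close> ends the sequence.\<close>

lemma card_perp_at_Suc:
  assumes X: "sing X"
  shows "(qnum s (Suc r))\<^sup>2 * card (perp_at X (Suc r))
    = s ^ (2 * r + 1) * qnum s (rk X - r) * res_pts (n - rk X - r) * card (perp_at X r)"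
proof -
  have "(\<Sum>Y\<in>perp_at X r. card {V \<in> perp_at X (Suc r). Suc (rk (Y \<inter> V)) = rk X})
      = (qnum s (Suc r))\<^sup>2 * card (perp_at X (Suc r))"
    using card_perp_at_down[OF X] by (intro sum_multicount finite_perp_at) auto
  moreover have "(\<Sum>Y\<in>perp_at X r. card {V \<in> perp_at X (Suc r). Suc (rk (Y \<inter> V)) = rk X})
      = (\<Sum>Y\<in>perp_at X r. s ^ (2 * r + 1) * qnum s (rk X - r) * res_pts (n - rk X - r))"
    by (intro sum.cong refl card_perp_at_up[OF X])
  ultimately show ?thesis by (simp add: mult.commute)
qed

lemma perp_at_0: "sing X \<Longrightarrow> perp_at X 0 = {X}"
proof -
  assume X: "sing X"
  have "Y = X" if "Y \<in> perp_at X 0" for Y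
  proof -
    have Y: "sing Y" "rk Y = rk X" "rk (X \<inter> Y) = rk X" using that by (auto simp: perp_at_def)
    have "X \<inter> Y = X" using Y X sing_Int by (intro rk_subset_eq) auto
    then have "X = Y" using Y X by (intro rk_subset_eq) auto
    then show ?thesis by simp
  qed
  moreover have "X \<in> perp_at X 0" using X sing_perp[OF X] by (simp add: perp_at_def)
  ultimately show ?thesis by blast
qed

subsection \<open>Degrees\<close>

text \<open>With \<open>x\<close> and \<open>y\<close> as in the proof,
  \<open>2 * Suc c \<le> n\<close> gives \<open>y \<le> x\<close>, so
  \<open>qnum_Suc_mult_le\<close> applies; the other factor of \<open>res_pts\<close> grows with its
  exponent. If \<open>c \<le> r\<close>, the left side is zero.\<close>

lemma res_pts_step_le:
  assumes "2 * Suc c \<le> n"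
  shows "qnum s (n - c - r) * res_pts (c - r) \<le> qnum s (n - Suc c - r) * res_pts (Suc c - r)"
proof (cases "r < c")
  case True
  define x y where "x = n - Suc c - r" and "y = c - r"
  have xy: "n - c - r = Suc x" "Suc c - r = Suc y" "y \<le> x" using assms True by (auto simp: x_def y_def)
  have "s ^ (y - 1) \<le> s ^ y" using s_gt_1 by (intro power_increasing) auto
  then have "t * s ^ (y - 1) + 1 \<le> t * s ^ y + 1" by simp
  then have "qnum s (Suc x) * qnum s y * (t * s ^ (y - 1) + 1) \<le> qnum s x * qnum s (Suc y) * (t * s ^ y + 1)"
    by (intro mult_le_mono qnum_Suc_mult_le[OF s_pos xy(3)])
  then show ?thesis
    unfolding xy(1,2) x_def[symmetric] y_def[symmetric] res_pts_def by (simp only: mult.assoc diff_Suc_1)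
qed (simp add: res_pts_def)

lemma res_pts_mono:
  assumes "c \<le> d" "2 * d \<le> n"
  shows "qnum s (n - c - r) * res_pts (c - r) \<le> qnum s (n - d - r) * res_pts (d - r)"
  using assms
proof (induction d rule: dec_induct)
  case (step d)
  then show ?case using res_pts_step_le[of d r] by simp
qed simp

text \<open>Induction from \<open>N 0 = 1\<close> along the recursion, whose factor is at least as
  large for the larger codimension, by \<open>res_pts_mono\<close>. The assumption
  \<open>half\<close> says that this codimension is at most \<open>n / 2\<close>.\<close>

lemma card_perp_at_mono:
  assumes X: "sing X" and X': "sing X'" and le: "rk X \<le> rk X'" and half: "n \<le> 2 * rk X"
  shows "card (perp_at X' r) \<le> card (perp_at X r)"
proof (induction r)
  case (Suc r)
  have a: "rk X = n - (n - rk X)" "rk X' = n - (n - rk X')" using rk_le[OF X] rk_le[OF X'] by auto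
  have "qnum s (rk X' - r) * res_pts (n - rk X' - r) \<le> qnum s (rk X - r) * res_pts (n - rk X - r)"
    using res_pts_mono[of "n - rk X'" "n - rk X" r] le half a by simp
  then have "s ^ (2 * r + 1) * (qnum s (rk X' - r) * res_pts (n - rk X' - r)) * card (perp_at X' r)
      \<le> s ^ (2 * r + 1) * (qnum s (rk X - r) * res_pts (n - rk X - r)) * card (perp_at X r)"
    by (rule mult_le_mono[OF mult_le_mono2 Suc.IH])
  then have "(qnum s (Suc r))\<^sup>2 * card (perp_at X' (Suc r)) \<le> (qnum s (Suc r))\<^sup>2 * card (perp_at X (Suc r))"
    using card_perp_at_Suc[OF X, of r] card_perp_at_Suc[OF X', of r] by (simp only: mult.assoc)
  then show ?case by simp
qed (simp add: perp_at_0 X X')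

text \<open>In the recursion, \<open>N r\<close> has a coefficient of at least
  \<open>2 * s ^ (2 * r + 1)\<close>, whereas
  \<open>[r + 1]\<^sup>2 < 4 * s ^ (2 * r) \<le> 2 * s ^ (2 * r + 1)\<close>.\<close>

lemma card_perp_at_Suc_less:
  assumes X: "sing X" and half: "n \<le> 2 * rk X" and r: "r < n - rk X" and pos: "0 < card (perp_at X r)"
  shows "card (perp_at X r) < card (perp_at X (Suc r))"
proof -
  define c where "c = n - rk X - r"
  have c: "0 < c" "0 < rk X - r" using half r by (auto simp: c_def)
  have q1: "1 \<le> qnum s (rk X - r)" using c qnum_less[OF c(2) s_pos] by simp
  have "2 \<le> res_pts c"
  proof -
    have "1 \<le> qnum s c" using qnum_less[OF c(1) s_pos] by simp
    moreover have "2 \<le> t * s ^ (c - 1) + 1" using t_pos s_pos by simp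
    ultimately have "1 * 2 \<le> qnum s c * (t * s ^ (c - 1) + 1)" by (rule mult_le_mono)
    then show ?thesis by (simp add: res_pts_def)
  qed
  then have "s ^ (2 * r + 1) * 1 * 2 \<le> s ^ (2 * r + 1) * qnum s (rk X - r) * res_pts c"
    using q1 by (intro mult_le_mono) auto
  moreover have "(qnum s (Suc r))\<^sup>2 < s ^ (2 * r + 1) * 2"
  proof -
    have "(qnum s (Suc r))\<^sup>2 < (2 * s ^ r)\<^sup>2"
      using qnum_Suc_less[OF s_gt_1] by (intro power_strict_mono) auto
    also have "\<dots> = 2 * 2 * s ^ (2 * r)" by (simp add: power_mult_distrib power_mult[symmetric] mult.commute)
    also have "\<dots> \<le> 2 * s * s ^ (2 * r)" using s_gt_1 by (intro mult_le_mono) auto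
    finally show ?thesis by (simp add: algebra_simps)
  qed
  ultimately have "(qnum s (Suc r))\<^sup>2 < s ^ (2 * r + 1) * qnum s (rk X - r) * res_pts c" by linarith
  then have "(qnum s (Suc r))\<^sup>2 * card (perp_at X r) < (qnum s (Suc r))\<^sup>2 * card (perp_at X (Suc r))"
    unfolding card_perp_at_Suc[OF X] c_def[symmetric] using pos by (intro mult_strict_right_mono)
  then show ?thesis by simp
qed

lemma card_perp_at_less:
  assumes X: "sing X" and half: "n \<le> 2 * rk X" and r: "r < d" "d \<le> n - rk X"
  shows "card (perp_at X r) < card (perp_at X d)"
proof -
  \<comment> \<open>The numbers grow strictly from \<open>N 0 = 1\<close> up to the codimension, so
    they stay positive.\<close>
  have pos: "0 < card (perp_at X k)" if "k \<le> n - rk X" for k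
    using that
  proof (induction k)
    case (Suc k)
    then show ?case using card_perp_at_Suc_less[OF X half, of k] by simp
  qed (simp add: perp_at_0 X)
  show ?thesis
    using r
  proof (induction d)
    case (Suc d)
    have "card (perp_at X d) < card (perp_at X (Suc d))"
      using Suc.prems pos[of d] by (intro card_perp_at_Suc_less[OF X half]) auto
    then show ?case using Suc by (cases "r = d") auto
  qed simp
qed

lemma perp_at_empty: "sing X \<Longrightarrow> n - rk X < r \<Longrightarrow> perp_at X r = {}"
proof (rule ccontr)
  assume X: "sing X" and r: "n - rk X < r" and "perp_at X r \<noteq> {}"
  then obtain Y where Y: "Y \<in> perp_at X r" by blast
  then have "sing (join X Y)" using sing_join[OF X] by (auto simp: perp_at_def)
  then show False using rk_le rk_join_perp_at[OF X Y] r by fastforce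
qed

section \<open>Degrees of the three graphs\<close>

definition perp_neighbours :: "'a set \<Rightarrow> 'a set set" where
  "perp_neighbours X = {Y. sing Y \<and> rk Y = rk X \<and> Y \<noteq> X \<and> perp L X Y}"

text \<open>The range up to \<open>n\<close> is the same for all ranks, so sums for different
  \<open>X\<close> can be compared termwise. Terms beyond the codimension vanish by
  \<open>perp_at_empty\<close>.\<close>

lemma card_perp_neighbours:
  assumes X: "sing X" shows "card (perp_neighbours X) = (\<Sum>r = 1..n. card (perp_at X r))"
proof -
  have "perp_neighbours X = (\<Union>r\<in>{1..n}. perp_at X r)"
  proof (intro equalityI subsetI)
    fix Y assume "Y \<in> perp_neighbours X"
    then have Y: "sing Y" "rk Y = rk X" "Y \<noteq> X" "perp L X Y" by (auto simp: perp_neighbours_def)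
    define r where "r = rk X - rk (X \<inter> Y)"
    have "rk (X \<inter> Y) \<le> rk X" by (intro rk_mono sing_Int X Y(1)) auto
    then have Yr: "Y \<in> perp_at X r" using Y by (simp add: perp_at_def r_def)
    then have "r \<noteq> 0" using Y(3) perp_at_0[OF X] by auto
    moreover have "r \<le> n" using rk_le[OF X] by (simp add: r_def)
    ultimately show "Y \<in> (\<Union>r\<in>{1..n}. perp_at X r)" using Yr by auto
  next
    fix Y assume "Y \<in> (\<Union>r\<in>{1..n}. perp_at X r)"
    then obtain r where "1 \<le> r" "Y \<in> perp_at X r" by auto
    then show "Y \<in> perp_neighbours X" by (auto simp: perp_at_def perp_neighbours_def)
  qed
  moreover have "card (\<Union>r\<in>{1..n}. perp_at X r) = (\<Sum>r = 1..n. card (perp_at X r))"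
    using finite_perp_at by (intro card_UN_disjoint) (auto simp: perp_at_def)
  ultimately show ?thesis by simp
qed

text \<open>The sums are compared termwise. Strictness comes from \<open>r = n - rk X\<close>: it
  exceeds the codimension of \<open>X'\<close>, so the term for \<open>X'\<close> is zero, while
  that for \<open>X\<close> is positive.\<close>

lemma card_perp_neighbours_less:
  assumes X: "sing X" and X': "sing X'" and less: "rk X < rk X'" and half: "n \<le> 2 * rk X"
  shows "card (perp_neighbours X') < card (perp_neighbours X)"
  unfolding card_perp_neighbours[OF X] card_perp_neighbours[OF X']
proof (rule sum_strict_mono_ex1)
  show "\<forall>r\<in>{1..n}. card (perp_at X' r) \<le> card (perp_at X r)"
    using card_perp_at_mono[OF X X' _ half] less by simp
  have "rk X' \<le> n" by (rule rk_le[OF X'])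
  then have c: "n - rk X' < n - rk X" using less by simp
  have "card (perp_at X' (n - rk X)) = 0" using perp_at_empty[OF X' c] by simp
  moreover have "card (perp_at X 0) < card (perp_at X (n - rk X))" using c by (intro card_perp_at_less[OF X half]) auto
  ultimately show "\<exists>r\<in>{1..n}. card (perp_at X' r) < card (perp_at X r)"
    using c by (intro bexI[of _ "n - rk X"]) auto
qed simp

lemma Delta_eq: "Delta P L u = {X. sing X \<and> rk X = Suc u}"
  unfolding Delta_def proj_dim_eq by auto

lemma Delta_nonempty:
  assumes "Suc u \<le> n" shows "\<exists>X. X \<in> Delta P L u"
proof -
  obtain M where "sing M" "rk M = n" using maximal_above[OF sing_empty] by (auto simp: maximal_iff)
  then show ?thesis
    using rank_between[of M "{}" "Suc u"] sing_empty assms by (auto simp: Delta_eq)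
qed

lemma perp_degree:
  "X \<in> Delta P L u \<Longrightarrow> card {Y \<in> Delta P L u. Y \<noteq> X \<and> perp L X Y} = card (perp_neighbours X)"
  by (rule arg_cong[where f = card]) (auto simp: Delta_eq perp_neighbours_def)

lemma perp_or_near_degree:
  assumes "X \<in> Delta P L u"
  shows "card {Y \<in> Delta P L u. Y \<noteq> X \<and> (perp L X Y \<or> hyp_adjacent P L u X Y)}
    = card (perp_neighbours X) + qnum s (rk X) * (t * s ^ (2 * (n - rk X)))"
proof -
  let ?N = "{Y. sing Y \<and> rk Y = rk X \<and> Suc (rk (X \<inter> Y)) = rk X \<and> \<not> perp L X Y}"
  have X: "sing X" "rk X = Suc u" using assms by (auto simp: Delta_eq)
  have "perp L X X" by (rule sing_perp[OF X(1)]) auto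
  then have "{Y \<in> Delta P L u. Y \<noteq> X \<and> (perp L X Y \<or> hyp_adjacent P L u X Y)} = perp_neighbours X \<union> ?N"
    using X by (auto simp: Delta_eq perp_neighbours_def hyp_adjacent_def proj_dim_eq)
  moreover have "perp_neighbours X \<inter> ?N = {}" by (auto simp: perp_neighbours_def)
  moreover have "finite (perp_neighbours X)" unfolding perp_neighbours_def by (rule finite_sing)
  moreover have "finite ?N" by (rule finite_sing)
  ultimately show ?thesis using card_near_nonperp[OF X(1)] by (simp add: card_Un_disjoint)
qed

text \<open>By the modular law, a join of rank \<open>n\<close> means an intersection of corank
  \<open>n - rk X\<close> in \<open>X\<close>. Removing \<open>X\<close> makes a difference only for
  maximal \<open>X\<close>, where \<open>perp_at X 0 = {X}\<close>.\<close>

lemma perp_max_neighbours: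
  assumes "X \<in> Delta P L u"
  shows "{Y \<in> Delta P L u. Y \<noteq> X \<and> perp_max P L n X Y} = perp_at X (n - rk X) - {X}"
proof -
  have X: "sing X" "rk X = Suc u" using assms by (auto simp: Delta_eq)
  have "rk (join X Y) = n \<longleftrightarrow> rk (X \<inter> Y) + (n - rk X) = rk X"
    if "sing Y" "rk Y = rk X" "perp L X Y" for Y
    using rk_modular[OF X(1) that(1,3)] that(2) rk_le[OF X(1)] rk_le[OF sing_join[OF X(1) that(1,3)]]
    by linarith
  then show ?thesis
    using X unfolding Delta_eq perp_max_def perp_at_def proj_dim_eq join_def[symmetric] by auto
qed

end

section \<open>Isomorphisms preserve degrees\<close>

lemma graph_iso_degree:
  assumes "graph_iso (graph_of V R) (graph_of W S)" "X \<in> V"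
  shows "\<exists>X'\<in>W. card {Y \<in> V. Y \<noteq> X \<and> R X Y} = card {Y \<in> W. Y \<noteq> X' \<and> S X' Y}"
proof -
  obtain f where f: "bij_betw f V W" and RS: "\<And>x y. x \<in> V \<Longrightarrow> y \<in> V \<Longrightarrow> x \<noteq> y \<Longrightarrow> R x y \<longleftrightarrow> S (f x) (f y)"
    using assms(1) unfolding graph_iso_graph_of_iff by blast
  have inj: "inj_on f V" and W: "W = f ` V" using f by (auto simp: bij_betw_def)
  have "{Y \<in> W. Y \<noteq> f X \<and> S (f X) Y} = f ` {Y \<in> V. Y \<noteq> X \<and> R X Y}"
    using RS[OF assms(2)] inj_on_eq_iff[OF inj _ assms(2)] by (auto simp: W)
  moreover have "inj_on f {Y \<in> V. Y \<noteq> X \<and> R X Y}" by (rule inj_on_subset[OF inj]) auto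
  ultimately have "card {Y \<in> V. Y \<noteq> X \<and> R X Y} = card {Y \<in> W. Y \<noteq> f X \<and> S (f X) Y}"
    by (simp add: card_image)
  then show ?thesis using assms(2) W by blast
qed

theorem theorem1p9:
  fixes P :: "'a set" and L :: "'a set set" and n s t i j :: nat
  assumes "finite_polar_space P L"
    and "n \<ge> 3"
    and "has_polar_rank P L n"
    and "has_polar_order P L n s t"
    and "(real n - 2) / 2 \<le> real i"
    and "i < j"
    and "j \<le> n - 1"
  shows "\<not> graph_iso (graph_of (Delta P L i) (perp L)) (graph_of (Delta P L j) (perp L)) \<and>
    \<not> graph_iso
        (graph_of (Delta P L i) (\<lambda>X Y. perp L X Y \<or> hyp_adjacent P L i X Y))
        (graph_of (Delta P L j) (\<lambda>X Y. perp L X Y \<or> hyp_adjacent P L j X Y)) \<and>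
    \<not> graph_iso
        (graph_of (Delta P L i) (perp_max P L n))
        (graph_of (Delta P L j) (perp_max P L n))"
proof -
  interpret finite_polar_space P L by (rule assms(1))
  interpret polar_space_of_order P L n s t by unfold_locales (rule assms(3), rule assms(4))
  \<comment> \<open>The lower bound on \<open>i\<close> says that the rank \<open>i + 1\<close> is
    at least \<open>n / 2\<close>.\<close>
  have ij: "n \<le> 2 * Suc i" "Suc i < Suc j" "Suc j \<le> n" using assms(2,5-) by auto
  obtain X where Xi: "X \<in> Delta P L i" using Delta_nonempty[of i] ij by auto
  then have X: "sing X" "rk X = Suc i" "n \<le> 2 * rk X" using ij by (auto simp: Delta_eq)
  have less: "card (perp_neighbours X') < card (perp_neighbours X)" if "sing X'" "rk X' = Suc j" for X'
    using card_perp_neighbours_less[OF X(1) that(1) _ X(3)] that X ij by simp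
  show ?thesis
  proof (intro conjI notI)
    assume "graph_iso (graph_of (Delta P L i) (perp L)) (graph_of (Delta P L j) (perp L))"
    from graph_iso_degree[OF this Xi] obtain X' where X': "X' \<in> Delta P L j"
      and "card (perp_neighbours X) = card (perp_neighbours X')"
      using perp_degree[OF Xi] perp_degree by auto
    then show False using less[of X'] by (auto simp: Delta_eq)
  next
    assume "graph_iso
        (graph_of (Delta P L i) (\<lambda>X Y. perp L X Y \<or> hyp_adjacent P L i X Y))
        (graph_of (Delta P L j) (\<lambda>X Y. perp L X Y \<or> hyp_adjacent P L j X Y))"
    from graph_iso_degree[OF this Xi] obtain X' where X': "X' \<in> Delta P L j"
      and eq: "card (perp_neighbours X) + qnum s (rk X) * (t * s ^ (2 * (n - rk X)))
        = card (perp_neighbours X') + qnum s (rk X') * (t * s ^ (2 * (n - rk X')))"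
      using perp_or_near_degree[OF Xi] perp_or_near_degree by auto
    have rX': "rk X' = Suc j" "sing X'" using X' by (auto simp: Delta_eq)
    \<comment> \<open>Raising the rank by \<open>j - i\<close> takes \<open>2 * (j - i)\<close> off
      the exponent of \<open>s\<close>, and \<open>[i + 1]\<close> gains at most the corresponding
      power of \<open>s\<close>.\<close>
    have "qnum s (Suc i + (j - i)) \<le> s ^ (2 * (j - i)) * qnum s (Suc i)"
      by (rule qnum_add_le[OF s_gt_1]) simp
    then have "qnum s (rk X') * (t * s ^ (2 * (n - rk X')))
        \<le> s ^ (2 * (j - i)) * qnum s (Suc i) * (t * s ^ (2 * (n - Suc j)))"
      using ij rX' by (intro mult_le_mono) simp_all
    also have "\<dots> = qnum s (rk X) * (t * s ^ (2 * (j - i) + 2 * (n - Suc j)))"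
      by (simp add: X power_add algebra_simps)
    also have "2 * (j - i) + 2 * (n - Suc j) = 2 * (n - rk X)" using X ij by simp
    finally show False using less[OF rX'(2,1)] eq by linarith
  next
    assume "graph_iso (graph_of (Delta P L i) (perp_max P L n)) (graph_of (Delta P L j) (perp_max P L n))"
    from graph_iso_degree[OF this Xi] obtain X' where X': "X' \<in> Delta P L j"
      and eq: "card (perp_at X (n - rk X) - {X}) = card (perp_at X' (n - rk X') - {X'})"
      using perp_max_neighbours[OF Xi] perp_max_neighbours by auto
    have rX': "sing X'" "rk X' = Suc j" using X' by (auto simp: Delta_eq)
    \<comment> \<open>The codimension of \<open>X\<close> is positive because
      \<open>i < j \<le> n - 1\<close>.\<close>
    have "X \<notin> perp_at X (n - rk X)" using X ij by (auto simp: perp_at_def)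
    then have "card (perp_at X (n - rk X)) = card (perp_at X' (n - rk X') - {X'})" using eq by simp
    also have "\<dots> \<le> card (perp_at X' (n - rk X'))" by (rule card_Diff1_le)
    \<comment> \<open>With codimensions \<open>c' < c\<close> of \<open>X'\<close> and
      \<open>X\<close>, and \<open>N'\<close> and \<open>N\<close> their counts, the chain is
      \<open>N' c' \<le> N c' < N c\<close>.\<close>
    also have "\<dots> \<le> card (perp_at X (n - rk X'))"
      using X rX' ij by (intro card_perp_at_mono) auto
    also have "\<dots> < card (perp_at X (n - rk X))"
      using X rX' ij by (intro card_perp_at_less) auto
    finally show False by simp
  qed
qed

end
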